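(* Let $X = X_{n,p}$ denote the number of Schur triples in $[n]_p$, i.e. the number of $3$-element subsets $\{x,y,z\} \subseteq [n]_p$ with $x + y = z$ (where $x \ne y$), and let $\mu = \mathbb{E} X$. Then for every $\varepsilon > 0$ there are constants $c, C > 0$ and $n_0$ (depending only on $\varepsilon$) such that for all $n \ge n_0$ and all $p \in (0,1]$ satisfying $1 \le (1+\varepsilon)\mu \le X_{n,1}$ we have $$\exp\Bigl(-C\min\bigl\{\mu,\; \mu^{1/2}\log(1/p)\bigr\}\Bigr) \le \mathbb{P}(X \ge (1+\varepsilon)\mu) \le \exp\Bigl(-c\min\bigl\{\mu,\; \mu^{1/2}\log(1/p)\bigr\}\Bigr).$$ For every fixed integer $\ell \ge 1$, the same statement (with $c,C,n_0$ also allowed to depend on $\ell$) holds when $X = X_{n,p}$ instead denotes the number of $\ell$-sums in $[n]_p$, i.e. the number of $3$-element subsets $\{x,y,z\} \subseteq [n]_p$ satisfying $x + y = \ell z$.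
   Context: $[n] = \{1,\dots,n\}$, and $[n]_p$ is the binomial random subset of $[n]$ in which each integer is included independently with probability $p$. A $3$-element subset is counted (once) if its elements can be labelled $x,y,z$ so that the given equation holds. $X_{n,1}$ is the (deterministic) value for $p=1$, i.e. the total number of relevant $3$-element subsets of $[n]$. *)

theory Defs
  imports "HOL-Probability.Probability"
begin

definition binomial_subset :: "nat \<Rightarrow> real \<Rightarrow> nat set pmf" where
  "binomial_subset n p =
     map_pmf (\<lambda>f. {i \<in> {1..n}. f i}) (Pi_pmf {1..n} False (\<lambda>_. bernoulli_pmf p))"

definition schur_triples :: "nat set \<Rightarrow> nat set set" where
  "schur_triples A =
     {T. T \<subseteq> A \<and> card T = 3 \<and> (\<exists>x y z. T = {x, y, z} \<and> x \<noteq> y \<and> x + y = z)}"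

definition l_sums :: "nat \<Rightarrow> nat set \<Rightarrow> nat set set" where
  "l_sums l A =
     {T. T \<subseteq> A \<and> card T = 3 \<and> (\<exists>x y z. T = {x, y, z} \<and> x + y = l * z)}"

definition schur_count :: "nat set \<Rightarrow> real" where
  "schur_count A = real (card (schur_triples A))"

definition l_sum_count :: "nat \<Rightarrow> nat set \<Rightarrow> real" where
  "l_sum_count l A = real (card (l_sums l A))"

end

(* The triples form a 3-uniform hypergraph on [n] with about n^2 edges in which two vertices lie
   in boundedly many common edges; the proof uses nothing else about the equation, except that
   intervals contain a positive proportion of the possible triples.

   Upper bound.  Fix m = C min(mu, mu^(1/2) log(1/p)) with C small.  Call S a core if |S| <= m, S
   spans at least eps mu / 8 edges and every vertex of S lies in at least eps mu / (8m) edges inside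
   S.  On the event that the random set contains no core, planting a set S of at most m vertices
   raises the mean of X to at most (1 + eps/2) mu, so the moment of order m/3 of X is at most
   ((1 + eps/2) mu)^(m/3) and Markov's inequality gives a bound exp(-c m).  Cores are rare because a
   core of size k is determined, up to (1 + log(1/p)^2)^O(k) choices, by about 7k/12 of its vertices:
   by the degree condition some small R in S leaves few isolated vertices in the graph joining v to
   w when {v, w, a} is an edge with a in R, and a graph without isolated vertices has a dominating
   set of at most half its size.  As k >= c mu^(1/2), the number of choices for these vertices is
   about (n/k)^(7k/12) <= O(1)^k p^(-7k/8), which is beaten by p^k.

   Lower bound.  An interval of O(mu^(1/2)) integers contains (1 + eps) mu triples, which gives
   exp(-C mu^(1/2) log(1/p)).  When mu <= log(1/p)^2, plant (1 + eps) mu disjoint triples one at a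
   time so that no further triple arises, and compare the truncated factorial moment of X with the
   probability that X >= (1 + eps) mu; this gives exp(-C mu). *)

theory Submission
  imports Defs "HOL-Real_Asymp.Real_Asymp"
begin

section \<open>Hypergraphs of bounded codegree\<close>

text \<open>Exponential weighting: since x \<le> 1, the factor x^(|F| - a) is at least 1 for every
  counted F, and summing x^|F| over all subsets of X gives (1 + x)^|X|. The parameter x is tuned at
  each use.\<close>

lemma card_small_subsets_le:
  fixes X :: "'a set" and a x :: real
  assumes "finite X" "0 < x" "x \<le> 1"
  shows "real (card {F. F \<subseteq> X \<and> real (card F) \<le> a}) \<le> x powr (-a) * exp (x * card X)"
proof -
  have "real (card {F. F \<subseteq> X \<and> real (card F) \<le> a}) = (\<Sum>F | F \<subseteq> X \<and> real (card F) \<le> a. 1)"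
    by simp
  also have "\<dots> \<le> (\<Sum>F | F \<subseteq> X \<and> real (card F) \<le> a. x powr (-a) * x ^ card F)"
  proof (rule sum_mono)
    fix F assume F: "F \<in> {F. F \<subseteq> X \<and> real (card F) \<le> a}"
    have "x powr (-a) * x ^ card F = x powr (real (card F) - a)"
      using assms by (simp add: powr_diff powr_realpow powr_minus field_simps)
    also have "\<dots> \<ge> x powr 0"
      using F assms by (intro powr_mono') auto
    finally show "1 \<le> x powr (-a) * x ^ card F" using assms by simp
  qed
  also have "\<dots> \<le> (\<Sum>F\<in>Pow X. x powr (-a) * x ^ card F)"
    using assms by (intro sum_mono2) auto
  also have "\<dots> = x powr (-a) * (\<Sum>F\<in>Pow X. \<Prod>i\<in>F. x)"
    by (simp add: sum_distrib_left)
  also have "(\<Sum>F\<in>Pow X. \<Prod>i\<in>F. x) = (\<Prod>i\<in>X. 1 + x)"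
    using prod_add[OF assms(1), of "\<lambda>_. x" "\<lambda>_. 1"] by (simp add: add.commute)
  also have "\<dots> \<le> exp (x * card X)"
    using assms by (simp add: exp_of_nat2_mult power_mono)
  finally show ?thesis by (simp add: mult_left_mono)
qed

text \<open>Ore: the complement of a minimal dominating set is dominating when no vertex is isolated.\<close>

lemma dominating_set_half:
  fixes W :: "'a set" and adj :: "'a \<Rightarrow> 'a \<Rightarrow> bool"
  assumes fin: "finite W"
    and sym: "\<And>u v. adj u v \<Longrightarrow> adj v u"
    and irr: "\<And>v. \<not> adj v v"
    and no_isolated: "\<And>v. v \<in> W \<Longrightarrow> \<exists>u\<in>W. adj v u"
  obtains F where "F \<subseteq> W" "2 * card F \<le> card W" "\<And>v. v \<in> W - F \<Longrightarrow> \<exists>u\<in>F. adj v u"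
proof -
  define dom where "dom F \<longleftrightarrow> F \<subseteq> W \<and> (\<forall>v\<in>W - F. \<exists>u\<in>F. adj v u)" for F
  have "dom W" by (auto simp: dom_def)
  then obtain F where F: "dom F" and min: "\<And>G. dom G \<Longrightarrow> card F \<le> card G"
    using ex_has_least_nat[of dom W card] by blast
  have finF: "finite F" using F fin by (auto simp: dom_def intro: finite_subset)
  \<comment> \<open>A vertex v of F without neighbour outside F could be removed from F: v itself
    has a neighbour in \<open>F - {v}\<close>, and no vertex outside F is adjacent to v. This
    contradicts the minimality of F.\<close>
  have "dom (W - F)"
    unfolding dom_def
  proof (intro conjI ballI)
    fix v assume "v \<in> W - (W - F)"
    then have v: "v \<in> F" "v \<in> W" using F by (auto simp: dom_def)
    show "\<exists>u\<in>W - F. adj v u"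
    proof (rule ccontr)
      assume neg: "\<not> ?thesis"
      obtain u where u: "u \<in> W" "adj v u" using no_isolated v by blast
      with neg irr have "u \<in> F - {v}" by auto
      have "dom (F - {v})"
        unfolding dom_def
      proof (intro conjI ballI)
        show "F - {v} \<subseteq> W" using F by (auto simp: dom_def)
        fix w assume w: "w \<in> W - (F - {v})"
        show "\<exists>u\<in>F - {v}. adj w u"
        proof (cases "w = v")
          case True then show ?thesis using u \<open>u \<in> F - {v}\<close> by auto
        next
          case False
          then have "w \<in> W - F" using w by auto
          then obtain x where "x \<in> F" "adj w x" using F by (auto simp: dom_def)
          moreover have "x \<noteq> v" using neg \<open>w \<in> W - F\<close> \<open>adj w x\<close> sym by auto
          ultimately show ?thesis by auto
        qed
      qed
      from min[OF this] show False
        using v finF by (metis card_Diff1_less not_less)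
    qed
  qed auto
  from min[OF this] have "card F \<le> card W - card F"
    using F finF by (simp add: dom_def card_Diff_subset)
  moreover have "card F \<le> card W" using F fin by (auto simp: dom_def intro: card_mono)
  ultimately have "2 * card F \<le> card W" by simp
  with F that show thesis by (auto simp: dom_def)
qed

section \<open>Edge counts in 3-uniform hypergraphs of codegree at most D\<close>

locale codegree_hypergraph =
  fixes V :: "'a set" and H :: "'a set set" and D :: nat
  assumes finite_V: "finite V"
    and edge_subset: "e \<in> H \<Longrightarrow> e \<subseteq> V"
    and edge_card: "e \<in> H \<Longrightarrow> card e = 3"
    and D_pos: "D > 0"
    and codegree: "a \<noteq> b \<Longrightarrow> card {e \<in> H. a \<in> e \<and> b \<in> e} \<le> D"
begin

lemma finite_H: "finite H"
  using finite_V edge_subset by (meson finite_Pow_iff finite_subset PowI subsetI)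

lemma finite_edge: "e \<in> H \<Longrightarrow> finite e"
  using edge_card by (metis card.infinite zero_neq_numeral)

lemma degree_meeting_le:
  assumes "finite S"
  shows "card {e \<in> H. v \<in> e \<and> (\<exists>u\<in>S. u \<noteq> v \<and> u \<in> e)} \<le> D * card S"
proof -
  have "{e \<in> H. v \<in> e \<and> (\<exists>u\<in>S. u \<noteq> v \<and> u \<in> e)} = (\<Union>u\<in>S - {v}. {e \<in> H. u \<in> e \<and> v \<in> e})"
    by auto
  also have "card \<dots> \<le> (\<Sum>u\<in>S - {v}. card {e \<in> H. u \<in> e \<and> v \<in> e})"
    using assms by (intro card_UN_le) auto
  also have "\<dots> \<le> (\<Sum>u\<in>S - {v}. D)"
    by (intro sum_mono codegree) auto
  also have "\<dots> \<le> D * card S"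
    using assms by (simp add: card_Diff1_le)
  finally show ?thesis .
qed

lemma other_vertex:
  assumes "e \<in> H" obtains u where "u \<in> e" "u \<noteq> v"
proof -
  have "\<not> e \<subseteq> {v}" using edge_card[OF assms] card_mono[of "{v}" e] by auto
  then show ?thesis using that by auto
qed

lemma degree_le: "card {e \<in> H. v \<in> e} \<le> D * card V"
proof -
  have "{e \<in> H. v \<in> e} \<subseteq> {e \<in> H. v \<in> e \<and> (\<exists>u\<in>V. u \<noteq> v \<and> u \<in> e)}"
  proof clarify
    fix e assume e: "e \<in> H" "v \<in> e"
    then obtain u where "u \<in> e" "u \<noteq> v" using other_vertex by metis
    then show "\<exists>u\<in>V. u \<noteq> v \<and> u \<in> e" using edge_subset[OF e(1)] by auto
  qed
  then have "card {e \<in> H. v \<in> e} \<le> card {e \<in> H. v \<in> e \<and> (\<exists>u\<in>V. u \<noteq> v \<and> u \<in> e)}"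
    using finite_H by (intro card_mono) auto
  also have "\<dots> \<le> D * card V" by (rule degree_meeting_le[OF finite_V])
  finally show ?thesis .
qed

lemma card_touching_le:
  assumes "finite S"
  shows "card {e \<in> H. e \<inter> S \<noteq> {}} \<le> card S * (D * card V)"
proof -
  have "{e \<in> H. e \<inter> S \<noteq> {}} = (\<Union>v\<in>S. {e \<in> H. v \<in> e})" by auto
  also have "card \<dots> \<le> (\<Sum>v\<in>S. card {e \<in> H. v \<in> e})"
    using assms by (intro card_UN_le) auto
  also have "\<dots> \<le> (\<Sum>v\<in>S. D * card V)"
    by (intro sum_mono degree_le)
  finally show ?thesis by simp
qed

definition two_in :: "'a set \<Rightarrow> 'a set \<Rightarrow> bool" where
  "two_in S e \<longleftrightarrow> (\<exists>a\<in>S. \<exists>b\<in>S. a \<noteq> b \<and> a \<in> e \<and> b \<in> e)"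

lemma card_two_in_le:
  assumes "finite S"
  shows "card {e \<in> H. two_in S e} \<le> D * (card S)\<^sup>2"
proof -
  have "{e \<in> H. two_in S e} = (\<Union>v\<in>S. {e \<in> H. v \<in> e \<and> (\<exists>u\<in>S. u \<noteq> v \<and> u \<in> e)})"
    by (auto simp: two_in_def)
  also have "card \<dots> \<le> (\<Sum>v\<in>S. card {e \<in> H. v \<in> e \<and> (\<exists>u\<in>S. u \<noteq> v \<and> u \<in> e)})"
    using assms by (intro card_UN_le) auto
  also have "\<dots> \<le> (\<Sum>v\<in>S. D * card S)"
    by (intro sum_mono degree_meeting_le assms)
  finally show ?thesis by (simp add: power2_eq_square mult_ac)
qed

lemma two_in_if_subset: "e \<in> H \<Longrightarrow> e \<subseteq> S \<Longrightarrow> two_in S e"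
  unfolding two_in_def by (metis other_vertex subsetD)

lemma card_inside_le:
  assumes "finite S"
  shows "card {e \<in> H. e \<subseteq> S} \<le> D * (card S)\<^sup>2"
proof -
  have "card {e \<in> H. e \<subseteq> S} \<le> card {e \<in> H. two_in S e}"
    using two_in_if_subset finite_H by (intro card_mono) auto
  then show ?thesis using card_two_in_le[OF assms] by linarith
qed

lemma card_H_le: "card H \<le> D * (card V)\<^sup>2"
proof -
  have "{e \<in> H. e \<subseteq> V} = H" using edge_subset by auto
  then show ?thesis using card_inside_le[OF finite_V] by simp
qed

text \<open>The mean number of edges in the random set conditioned on containing S;
  \<open>sum_w_edge_count\<close> makes this precise.\<close>

definition planted_mean :: "real \<Rightarrow> 'a set \<Rightarrow> real" where
  "planted_mean p S = (\<Sum>e\<in>H. p ^ card (e - S))"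

text \<open>Edges are sorted by how many vertices they have in S: any number, at least one, at least
  two, all three. The correspondingly weighted indicators dominate \<open>p ^ card (e - S)\<close>,
  and the codegree bound counts the two middle classes.\<close>

lemma planted_mean_le:
  fixes p :: real
  assumes "finite S" "0 < p" "p \<le> 1"
  shows "planted_mean p S \<le> card H * p ^ 3 + p\<^sup>2 * (card S * (D * card V)) + p * (D * (card S)\<^sup>2)
           + card {e \<in> H. e \<subseteq> S}"
proof -
  have "p ^ card (e - S) \<le> p ^ 3 + p\<^sup>2 * of_bool (e \<inter> S \<noteq> {}) + p * of_bool (two_in S e)
      + of_bool (e \<subseteq> S)" if e: "e \<in> H" for e
  proof -
    have c: "card (e - S) + card (e \<inter> S) = 3"
      using edge_card[OF e] card_Diff_subset_Int[of e S] finite_edge[OF e]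
      by (metis card_Int_Diff add.commute)
    have fe: "finite e" using finite_edge[OF e] .
    consider "card (e - S) = 0" | "card (e - S) = 1" | "card (e - S) = 2" | "card (e - S) = 3"
      using c by linarith
    then show ?thesis
    proof cases
      case 1
      then have "e \<subseteq> S" using fe by auto
      then show ?thesis using 1 assms by simp
    next
      case 2
      then have "card (e \<inter> S) = 2" using c by simp
      then obtain x y where "e \<inter> S = {x, y}" "x \<noteq> y" by (auto simp: card_2_iff)
      then have "two_in S e" unfolding two_in_def by blast
      then show ?thesis using 2 assms by simp
    next
      case 3
      then have "e \<inter> S \<noteq> {}" using c by auto
      then show ?thesis using 3 assms by simp
    next
      case 4
      then show ?thesis using assms by simp
    qed
  qed
  then have "planted_mean p S \<le> (\<Sum>e\<in>H. p ^ 3 + p\<^sup>2 * of_bool (e \<inter> S \<noteq> {}) + p * of_bool (two_in S e)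
      + of_bool (e \<subseteq> S))"
    unfolding planted_mean_def by (rule sum_mono)
  also have "\<dots> = card H * p ^ 3 + p\<^sup>2 * card {e \<in> H. e \<inter> S \<noteq> {}} + p * card {e \<in> H. two_in S e}
      + card {e \<in> H. e \<subseteq> S}"
    using finite_H by (simp add: sum.distrib sum_distrib_left[symmetric] of_bool_def
        sum.If_cases Int_def conj_commute)
  also have "\<dots> \<le> card H * p ^ 3 + p\<^sup>2 * (card S * (D * card V)) + p * (D * (card S)\<^sup>2)
           + card {e \<in> H. e \<subseteq> S}"
    using card_touching_le[OF assms(1)] card_two_in_le[OF assms(1)] assms
    by (intro add_mono mult_left_mono order_refl) (simp_all flip: of_nat_mult of_nat_power)
  finally show ?thesis .
qed

text \<open>Take T of least size among the subsets with at least \<open>t + d * card T\<close>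
  edges. Deleting a vertex of degree below d loses fewer than d edges while the threshold drops by
  d, so T has no such vertex.\<close>

lemma min_degree_subset:
  fixes d :: real
  assumes "finite S" "0 \<le> d" "t + d * card S \<le> card {e \<in> H. e \<subseteq> S}"
  obtains T where "T \<subseteq> S" "t \<le> card {e \<in> H. e \<subseteq> T}"
    "\<And>v. v \<in> T \<Longrightarrow> d \<le> card {e \<in> H. e \<subseteq> T \<and> v \<in> e}"
proof -
  define Q where "Q T \<longleftrightarrow> T \<subseteq> S \<and> t + d * card T \<le> card {e \<in> H. e \<subseteq> T}" for T
  have "Q S" using assms by (simp add: Q_def)
  then obtain T where T: "Q T" and min: "\<And>T'. Q T' \<Longrightarrow> card T \<le> card T'"
    using ex_has_least_nat[of Q S card] by blast
  have finT: "finite T" using T assms(1) by (auto simp: Q_def intro: finite_subset)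
  have "d \<le> card {e \<in> H. e \<subseteq> T \<and> v \<in> e}" if v: "v \<in> T" for v
  proof (rule ccontr)
    assume neg: "\<not> ?thesis"
    have "{e \<in> H. e \<subseteq> T} = {e \<in> H. e \<subseteq> T - {v}} \<union> {e \<in> H. e \<subseteq> T \<and> v \<in> e}" by auto
    then have "card {e \<in> H. e \<subseteq> T} \<le> card {e \<in> H. e \<subseteq> T - {v}} + card {e \<in> H. e \<subseteq> T \<and> v \<in> e}"
      by (simp add: card_Un_le)
    then have "real (card {e \<in> H. e \<subseteq> T}) \<le> real (card {e \<in> H. e \<subseteq> T - {v}}) + card {e \<in> H. e \<subseteq> T \<and> v \<in> e}"
      by linarith
    moreover have "real (card T) = card (T - {v}) + 1"
      using v finT by (metis Suc_eq_plus1 card_Suc_Diff1 of_nat_1 of_nat_add)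
    ultimately have "Q (T - {v})"
      using T neg by (auto simp: Q_def algebra_simps)
    from min[OF this] show False using v finT by (metis card_Diff1_less not_less)
  qed
  moreover have "t \<le> card {e \<in> H. e \<subseteq> T}"
  proof -
    have "0 \<le> d * card T" using assms(2) by simp
    then show ?thesis using T unfolding Q_def by linarith
  qed
  moreover have "T \<subseteq> S" using T by (simp add: Q_def)
  ultimately show thesis using that by blast
qed

section \<open>Encoding sets of large minimum degree by few of their vertices\<close>

definition neighbours :: "'a set \<Rightarrow> 'a set \<Rightarrow> 'a set" where
  "neighbours R F = \<Union>{e \<in> H. \<exists>v\<in>F. \<exists>a\<in>R. v \<noteq> a \<and> v \<in> e \<and> a \<in> e}"

lemma finite_neighbours: "finite (neighbours R F)"
  unfolding neighbours_def using finite_H finite_edge by auto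

lemma card_neighbours_le:
  assumes "finite R" "finite F"
  shows "card (neighbours R F) \<le> 3 * D * card F * card R"
proof -
  have fin: "finite {(v, a) \<in> F \<times> R. v \<noteq> a}"
    by (rule finite_subset[of _ "F \<times> R"]) (use assms in auto)
  have "{e \<in> H. \<exists>v\<in>F. \<exists>a\<in>R. v \<noteq> a \<and> v \<in> e \<and> a \<in> e}
      = (\<Union>(v, a)\<in>{(v, a) \<in> F \<times> R. v \<noteq> a}. {e \<in> H. v \<in> e \<and> a \<in> e})" (is "?E = _")
    by auto
  also have "card \<dots> \<le> (\<Sum>(v, a)\<in>{(v, a) \<in> F \<times> R. v \<noteq> a}. card {e \<in> H. v \<in> e \<and> a \<in> e})"
    by (rule order_trans[OF card_UN_le[OF fin]]) (simp add: case_prod_unfold)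
  also have "\<dots> \<le> (\<Sum>(v, a)\<in>{(v, a) \<in> F \<times> R. v \<noteq> a}. D)"
    using codegree by (intro sum_mono) auto
  also have "\<dots> \<le> card F * card R * D"
  proof -
    have "card {(v, a) \<in> F \<times> R. v \<noteq> a} \<le> card (F \<times> R)"
      using assms by (intro card_mono) auto
    then show ?thesis using assms by (simp add: card_cartesian_product case_prod_unfold)
  qed
  finally have E: "card ?E \<le> card F * card R * D" .
  have "card (\<Union>?E) \<le> (\<Sum>e\<in>?E. card e)"
    by (rule card_Union_le_sum_card)
  also have "\<dots> \<le> (\<Sum>e\<in>?E. 3)"
    by (intro sum_mono) (auto simp: edge_card)
  also have "\<dots> \<le> 3 * (card F * card R * D)" using E by simp
  finally show ?thesis by (simp add: neighbours_def mult_ac)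
qed

text \<open>R is taken of greatest size among the sets whose vertices cover, on average, at least d
  / (12 D) vertices each. If more than a twelfth of S stayed uncovered, averaging would produce one
  more vertex that covers that many new ones.\<close>

lemma covering_set:
  fixes d :: real
  assumes finS: "finite S" and d: "d > 0"
    and deg: "\<And>v. v \<in> S \<Longrightarrow> d \<le> card {e \<in> H. e \<subseteq> S \<and> v \<in> e}"
  obtains R where "R \<subseteq> S" "card R * d \<le> 12 * D * card S"
    "12 * card {v \<in> S. \<not> (\<exists>e\<in>H. e \<subseteq> S \<and> v \<in> e \<and> (\<exists>a\<in>R. a \<in> e \<and> a \<noteq> v))} \<le> card S"
proof -
  define hit where "hit a v \<longleftrightarrow> (\<exists>e\<in>H. e \<subseteq> S \<and> v \<in> e \<and> a \<in> e \<and> a \<noteq> v)" for a v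
  define cov where "cov R = {v \<in> S. \<exists>a\<in>R. hit a v}" for R
  define Q where "Q R \<longleftrightarrow> R \<subseteq> S \<and> card R * d \<le> 12 * D * card (cov R)" for R
  have "Q {}" by (simp add: Q_def)
  moreover have "\<forall>R. Q R \<longrightarrow> card R \<le> card S"
    using finS by (auto simp: Q_def intro: card_mono)
  ultimately have "\<exists>R. Q R \<and> (\<forall>R'. Q R' \<longrightarrow> card R' \<le> card R)"
    by (intro ex_has_greatest_nat[of Q "{}" card "Suc (card S)"]) (auto simp: less_Suc_eq_le)
  then obtain R where R: "Q R" and max: "\<And>R'. Q R' \<Longrightarrow> card R' \<le> card R"
    by blast
  have RS: "R \<subseteq> S" and finR: "finite R"
    using R finS by (auto simp: Q_def intro: finite_subset)
  have fincov: "finite (cov R)" for R using finS by (simp add: cov_def)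
  define U where "U = S - cov R"
  have finU: "finite U" using finS by (simp add: U_def)
  have "12 * card U \<le> card S"
  proof (rule ccontr)
    assume large: "\<not> ?thesis"
    \<comment> \<open>The degree of v is spread over many vertices: each a shares at most D edges
      with v, so at least d / D vertices hit v.\<close>
    have hits: "d \<le> D * card {a \<in> S. hit a v}" if v: "v \<in> S" for v
    proof -
      have "{e \<in> H. e \<subseteq> S \<and> v \<in> e} \<subseteq> (\<Union>a\<in>{a \<in> S. hit a v}. {e \<in> H. a \<in> e \<and> v \<in> e})"
      proof clarify
        fix e assume e: "e \<in> H" "e \<subseteq> S" "v \<in> e"
        then obtain a where "a \<in> e" "a \<noteq> v" using other_vertex by metis
        then show "e \<in> (\<Union>a\<in>{a \<in> S. hit a v}. {e \<in> H. a \<in> e \<and> v \<in> e})"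
          using e by (auto simp: hit_def)
      qed
      then have "card {e \<in> H. e \<subseteq> S \<and> v \<in> e} \<le> card (\<Union>a\<in>{a \<in> S. hit a v}. {e \<in> H. a \<in> e \<and> v \<in> e})"
        using finite_H finS by (intro card_mono) auto
      also have "\<dots> \<le> (\<Sum>a\<in>{a \<in> S. hit a v}. card {e \<in> H. a \<in> e \<and> v \<in> e})"
        using finS by (intro card_UN_le) auto
      also have "\<dots> \<le> (\<Sum>a\<in>{a \<in> S. hit a v}. D)"
        by (intro sum_mono codegree) (auto simp: hit_def)
      finally have "card {e \<in> H. e \<subseteq> S \<and> v \<in> e} \<le> D * card {a \<in> S. hit a v}" by (simp add: mult.commute)
      then have "real (card {e \<in> H. e \<subseteq> S \<and> v \<in> e}) \<le> D * card {a \<in> S. hit a v}"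
        by (simp only: of_nat_le_iff flip: of_nat_mult)
      with deg[OF v] show ?thesis by linarith
    qed
    have "(\<Sum>a\<in>S. D * card {v \<in> U. hit a v}) = D * (\<Sum>v\<in>U. card {a \<in> S. hit a v})"
      using sum.swap_restrict[OF finS finU, of "\<lambda>_ _. 1::nat" hit]
      by (simp flip: sum_distrib_left)
    then have "real (\<Sum>a\<in>S. D * card {v \<in> U. hit a v}) = (\<Sum>v\<in>U. D * card {a \<in> S. hit a v})"
      by (simp add: sum_distrib_left)
    also have "\<dots> \<ge> (\<Sum>v\<in>U. d)"
    proof -
      have "(\<Sum>v\<in>U. d) \<le> (\<Sum>v\<in>U. real (D * card {a \<in> S. hit a v}))"
        using hits by (intro sum_mono) (auto simp: U_def)
      then show ?thesis by simp
    qed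
    finally have sum_ge: "card U * d \<le> real (\<Sum>a\<in>S. D * card {v \<in> U. hit a v})" by simp
    \<comment> \<open>Double counting gives at least |U| d / D pairs (a, v) with v uncovered. As |U|
      > |S| / 12, an average vertex a hits more than d / (12 D) uncovered vertices.\<close>
    have "\<exists>a\<in>S. d \<le> 12 * D * card {v \<in> U. hit a v}"
    proof (rule ccontr)
      assume "\<not> ?thesis"
      then have "12 * real (\<Sum>a\<in>S. D * card {v \<in> U. hit a v}) \<le> (\<Sum>a\<in>S. d)"
        unfolding of_nat_sum sum_distrib_left by (intro sum_mono) force
      then have "12 * card U * d \<le> card S * d" using sum_ge by simp
      with d large show False by simp
    qed
    then obtain a where a: "a \<in> S" "d \<le> 12 * D * card {v \<in> U. hit a v}" by auto
    have "card {v \<in> U. hit a v} > 0" using a d by (intro gr0I) auto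
    then obtain v where "v \<in> U" "hit a v" by (metis (no_types, lifting) Collect_empty_eq card_gt_0_iff)
    then have "a \<notin> R" by (auto simp: U_def cov_def)
    have "cov (insert a R) = cov R \<union> {v \<in> U. hit a v}" "cov R \<inter> {v \<in> U. hit a v} = {}"
      by (auto simp: cov_def U_def)
    then have "card (cov (insert a R)) = card (cov R) + card {v \<in> U. hit a v}"
      using finU fincov by (simp add: card_Un_disjoint)
    then have "Q (insert a R)"
      using R a \<open>a \<notin> R\<close> finR by (simp add: Q_def algebra_simps)
    from max[OF this] show False using \<open>a \<notin> R\<close> finR by simp
  qed
  moreover have "U = {v \<in> S. \<not> (\<exists>e\<in>H. e \<subseteq> S \<and> v \<in> e \<and> (\<exists>a\<in>R. a \<in> e \<and> a \<noteq> v))}"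
    by (auto simp: U_def cov_def hit_def)
  moreover have "card R * d \<le> 12 * D * card S"
  proof -
    have "card (cov R) \<le> card S" using finS by (intro card_mono) (auto simp: cov_def)
    then have "12 * D * card (cov R) \<le> 12 * D * card S" by simp
    then have "real (12 * D * card (cov R)) \<le> 12 * D * card S" by (simp only: of_nat_le_iff)
    then show ?thesis using R by (simp add: Q_def)
  qed
  ultimately show thesis using that[OF RS] by simp
qed

text \<open>A set of large minimum degree is generated by slightly more than half of its vertices:
  joining \<open>v\<close> and \<open>w\<close> whenever \<open>{v, w, a}\<close> is an edge for some \<open>a\<close> in the small set \<open>R\<close>
  leaves few isolated vertices, and the others have a dominating set of at most half their number.\<close>

lemma core_generators:
  fixes d :: real
  assumes finS: "finite S" and d: "d > 0"
    and deg: "\<And>v. v \<in> S \<Longrightarrow> d \<le> card {e \<in> H. e \<subseteq> S \<and> v \<in> e}"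
  obtains R F where "R \<subseteq> S" "F \<subseteq> S" "card R * d \<le> 12 * D * card S" "24 * card F \<le> 13 * card S"
    "S \<subseteq> F \<union> neighbours R F"
proof -
  obtain R where R: "R \<subseteq> S" "card R * d \<le> 12 * D * card S"
    and U12: "12 * card {v \<in> S. \<not> (\<exists>e\<in>H. e \<subseteq> S \<and> v \<in> e \<and> (\<exists>a\<in>R. a \<in> e \<and> a \<noteq> v))} \<le> card S"
    using covering_set[OF finS d deg] by blast
  define U where "U = {v \<in> S. \<not> (\<exists>e\<in>H. e \<subseteq> S \<and> v \<in> e \<and> (\<exists>a\<in>R. a \<in> e \<and> a \<noteq> v))}"
  define adj where "adj v w \<longleftrightarrow> v \<noteq> w \<and> (\<exists>e\<in>H. e \<subseteq> S \<and> v \<in> e \<and> w \<in> e \<and> (\<exists>a\<in>R. a \<in> e \<and> a \<noteq> v \<and> a \<noteq> w))" for v w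
  have sym: "adj u v \<Longrightarrow> adj v u" for u v unfolding adj_def by metis
  have irr: "\<not> adj v v" for v by (simp add: adj_def)
  have no_isolated: "\<exists>u\<in>S - U. adj v u" if v: "v \<in> S - U" for v
  proof -
    obtain e a where e: "e \<in> H" "e \<subseteq> S" "v \<in> e" "a \<in> R" "a \<in> e" "a \<noteq> v"
      using v by (auto simp: U_def)
    \<comment> \<open>The third vertex w of e is covered by the same a. Hence w lies outside U and
      is joined to v.\<close>
    have "card {v, a} < card e" using edge_card[OF e(1)] e(6) by simp
    then have "\<not> e \<subseteq> {v, a}" by (meson card_mono finite.emptyI finite_insert leD)
    then obtain w where "w \<in> e" "w \<noteq> v" "w \<noteq> a" by auto
    then have "w \<in> S - U" "adj v w" using e by (auto simp: U_def adj_def)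
    then show ?thesis by blast
  qed
  obtain F0 where F0: "F0 \<subseteq> S - U" "2 * card F0 \<le> card (S - U)"
    and dom: "\<And>v. v \<in> S - U - F0 \<Longrightarrow> \<exists>u\<in>F0. adj v u"
    using dominating_set_half[of "S - U" adj, OF _ sym irr no_isolated] finS
    by (metis (no_types, lifting) finite_Diff)
  have US: "U \<subseteq> S" by (auto simp: U_def)
  have finU: "finite U" using US finS finite_subset by blast
  have "card (S - U) + card U = card S"
    using card_Diff_subset[OF finU US] card_mono[OF finS US] by simp
  moreover have "card (F0 \<union> U) \<le> card F0 + card U" by (rule card_Un_le)
  \<comment> \<open>The set F0 has at most half of |S| - |U| elements, so 24 |F0 \<union> U| \<le>
    12 (|S| - |U|) + 24 |U| = 12 |S| + 12 |U| \<le> 13 |S|.\<close>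
  ultimately have "24 * card (F0 \<union> U) \<le> 13 * card S"
    using F0(2) U12[folded U_def] by linarith
  moreover have "S \<subseteq> (F0 \<union> U) \<union> neighbours R (F0 \<union> U)"
  proof
    fix v assume "v \<in> S"
    show "v \<in> (F0 \<union> U) \<union> neighbours R (F0 \<union> U)"
    proof (cases "v \<in> F0 \<union> U")
      case False
      then obtain u where u: "u \<in> F0" "adj v u" using dom \<open>v \<in> S\<close> by blast
      then obtain e a where "e \<in> H" "v \<in> e" "u \<in> e" "a \<in> R" "a \<in> e" "u \<noteq> a"
        unfolding adj_def by auto
      then have "v \<in> neighbours R (F0 \<union> U)"
        using u(1) unfolding neighbours_def by auto
      then show ?thesis by simp
    qed simp
  qed
  ultimately show thesis using that[of R "F0 \<union> U"] R F0(1) US by blast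
qed

text \<open>By \<open>core_generators\<close>, S is determined by R, F and a subset of
  \<open>F \<union> neighbours R F\<close> of size k. The sizes k / 24 and 13 k / 24 of R and F add
  up to the exponent 7 k / 12. The last choice takes place among at most k (1 + 3 D \<beta>)
  vertices, so its cost is only the k-th power of a factor linear in \<beta>.\<close>

lemma card_cores_le:
  fixes d \<beta> :: real
  assumes k: "0 < k" and d: "288 * D \<le> d" and \<beta>: "12 * D * real k \<le> \<beta> * d"
    and kV: "k \<le> card V"
  shows "real (card {S. S \<subseteq> V \<and> card S = k \<and> (\<forall>v\<in>S. d \<le> card {e \<in> H. e \<subseteq> S \<and> v \<in> e})})
    \<le> (card V / k) powr (7 * k / 12) * (exp 3 * (1 + 3 * D * \<beta>)) ^ k"
proof -
  define n where "n = real (card V)"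
  \<comment> \<open>Both bounds on |R| come from |R| d \<le> 12 D k: the bound k / 24 keeps the
    number of choices for R small, and \<beta> keeps the neighbourhood of F small.\<close>
  define RR where "RR = {R. R \<subseteq> V \<and> real (card R) \<le> min \<beta> (k / 24)}"
  define FF where "FF = {F. F \<subseteq> V \<and> real (card F) \<le> 13 * k / 24}"
  define GG where "GG R F = {S. S \<subseteq> F \<union> neighbours R F \<and> real (card S) \<le> k}" for R F
  have dpos: "d > 0" using d D_pos by (metis (no_types) of_nat_0_less_iff less_le_trans mult_pos_pos zero_less_numeral)
  have \<beta>0: "\<beta> \<ge> 0"
  proof -
    have "0 \<le> \<beta> * d" using \<beta> by (meson of_nat_0_le_iff mult_nonneg_nonneg order_trans zero_le_numeral)
    then show ?thesis using dpos by (simp add: zero_le_mult_iff)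
  qed
  have n: "n \<ge> k" "n > 0" using kV k by (auto simp: n_def)
  have finRR: "finite RR" and finFF: "finite FF"
    using finite_V by (simp_all add: RR_def FF_def)
  have finR: "finite R" "real (card R) \<le> \<beta>" if "R \<in> RR" for R
    using that finite_V by (auto simp: RR_def intro: finite_subset)
  have finF: "finite F" "real (card F) \<le> k" if "F \<in> FF" for F
    using that finite_V by (auto simp: FF_def intro: finite_subset)
  have finGG: "finite (GG R F)" if "R \<in> RR" "F \<in> FF" for R F
    using that finite_neighbours finF by (auto simp: GG_def)
  have "{S. S \<subseteq> V \<and> card S = k \<and> (\<forall>v\<in>S. d \<le> card {e \<in> H. e \<subseteq> S \<and> v \<in> e})}
      \<subseteq> (\<Union>R\<in>RR. \<Union>F\<in>FF. GG R F)" (is "?C \<subseteq> _")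
  proof clarify
    fix S assume S: "S \<subseteq> V" "k = card S" "\<forall>v\<in>S. d \<le> card {e \<in> H. e \<subseteq> S \<and> v \<in> e}"
    have finS: "finite S" using S finite_V finite_subset by blast
    obtain R F where RF: "R \<subseteq> S" "F \<subseteq> S" "card R * d \<le> 12 * D * card S" "24 * card F \<le> 13 * card S"
      "S \<subseteq> F \<union> neighbours R F"
      using core_generators[OF finS dpos] S(3) by blast
    have "card R * d \<le> \<beta> * d" using RF(3) \<beta> S(2) by simp
    then have "card R \<le> \<beta>" using dpos by simp
    moreover have "card R \<le> real k / 24"
    proof -
      have "288 * D * real (card R) \<le> d * card R" using d by (intro mult_right_mono) auto
      also have "\<dots> \<le> 12 * D * k" using RF(3) S(2) by (simp add: mult.commute)
      finally show ?thesis using D_pos by simp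
    qed
    moreover have "card F \<le> 13 * real k / 24"
      using RF(4) S(2) by linarith
    moreover have "R \<subseteq> V" "F \<subseteq> V" using RF S by auto
    ultimately have "R \<in> RR" "F \<in> FF" "S \<in> GG R F"
      using RF S by (auto simp: RR_def FF_def GG_def)
    then show "S \<in> (\<Union>R\<in>RR. \<Union>F\<in>FF. GG R F)" by blast
  qed
  then have "card ?C \<le> card (\<Union>R\<in>RR. \<Union>F\<in>FF. GG R F)"
    using finRR finFF finGG by (intro card_mono) auto
  also have "\<dots> \<le> (\<Sum>R\<in>RR. card (\<Union>F\<in>FF. GG R F))"
    by (rule card_UN_le[OF finRR])
  also have "\<dots> \<le> (\<Sum>R\<in>RR. \<Sum>F\<in>FF. card (GG R F))"
    by (intro sum_mono card_UN_le finFF)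
  finally have "real (card ?C) \<le> (\<Sum>R\<in>RR. \<Sum>F\<in>FF. real (card (GG R F)))"
    by (simp flip: of_nat_sum)
  also have "\<dots> \<le> (\<Sum>R\<in>RR. \<Sum>F\<in>FF. (exp 1 * (1 + 3 * D * \<beta>)) ^ k)"
  proof (intro sum_mono)
    fix R F assume R: "R \<in> RR" and F: "F \<in> FF"
    \<comment> \<open>This x makes the exponent \<open>x * card (F \<union> neighbours R F)\<close>
      at most k.\<close>
    define x where "x = 1 / (1 + 3 * D * \<beta>)"
    have x: "0 < x" "x \<le> 1" using \<beta>0 by (auto simp: x_def add_pos_nonneg)
    have fin: "finite (F \<union> neighbours R F)" using finF[OF F] finite_neighbours by simp
    have "real (card (F \<union> neighbours R F)) \<le> real (card F) + real (card (neighbours R F))"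
      by (metis card_Un_le of_nat_add of_nat_le_iff)
    also have "real (card (neighbours R F)) \<le> 3 * real D * real (card F) * real (card R)"
    proof -
      have "real (card (neighbours R F)) \<le> real (3 * D * card F * card R)"
        using card_neighbours_le[OF finR(1)[OF R] finF(1)[OF F]] by (simp only: of_nat_le_iff)
      then show ?thesis by simp
    qed
    also have "\<dots> \<le> 3 * real D * real k * \<beta>"
      using finR(2)[OF R] finF(2)[OF F] \<beta>0 by (intro mult_mono) auto
    finally have "real (card (F \<union> neighbours R F)) \<le> k * (1 + 3 * D * \<beta>)"
      using finF(2)[OF F] by (simp add: algebra_simps)
    then have xk: "x * card (F \<union> neighbours R F) \<le> k"
      using \<beta>0 by (simp add: x_def field_simps add_pos_nonneg)
    have "real (card (GG R F)) \<le> x powr (- real k) * exp (x * card (F \<union> neighbours R F))"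
      unfolding GG_def by (rule card_small_subsets_le[OF fin x])
    also have "\<dots> \<le> x powr (- real k) * exp k"
      using xk by (intro mult_left_mono) auto
    also have "\<dots> = (exp 1 * (1 + 3 * D * \<beta>)) ^ k"
    proof -
      have "x powr (- real k) = inverse x ^ k"
        using x by (simp add: powr_minus powr_realpow power_inverse)
      moreover have "exp (real k) = exp 1 ^ k"
        by (simp add: exp_of_nat_mult[symmetric])
      ultimately show ?thesis by (simp add: x_def power_mult_distrib mult.commute)
    qed
    finally show "real (card (GG R F)) \<le> (exp 1 * (1 + 3 * D * \<beta>)) ^ k" .
  qed
  also have "\<dots> = real (card RR) * real (card FF) * (exp 1 * (1 + 3 * D * \<beta>)) ^ k"
    by simp
  also have "\<dots> \<le> ((n / k) powr (k / 24) * exp 1 ^ k) * ((n / k) powr (13 * k / 24) * exp 1 ^ k) * (exp 1 * (1 + 3 * D * \<beta>)) ^ k"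
  proof (intro mult_mono)
    \<comment> \<open>The weight x = k / n balances the two factors: the exponential one becomes exp
      k.\<close>
    have *: "real (card {F. F \<subseteq> V \<and> real (card F) \<le> a}) \<le> (n / k) powr a * exp 1 ^ k" for a
    proof -
      have "real (card {F. F \<subseteq> V \<and> real (card F) \<le> a}) \<le> (k / n) powr (-a) * exp (k / n * card V)"
        using k n by (intro card_small_subsets_le finite_V) auto
      moreover have "(k / n) powr (-a) = (n / k) powr a"
        using k n by (simp add: powr_minus powr_divide field_simps)
      moreover have "exp (k / n * card V) = exp 1 ^ k"
        using n by (simp add: n_def exp_of_nat_mult[symmetric])
      ultimately show ?thesis by simp
    qed
    show "real (card FF) \<le> (n / k) powr (13 * k / 24) * exp 1 ^ k"
      unfolding FF_def by (rule *)
    have "RR \<subseteq> {F. F \<subseteq> V \<and> real (card F) \<le> k / 24}" by (auto simp: RR_def)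
    then have "card RR \<le> card {F. F \<subseteq> V \<and> real (card F) \<le> k / 24}"
      using finite_V by (intro card_mono) auto
    with *[of "k / 24"] show "real (card RR) \<le> (n / k) powr (k / 24) * exp 1 ^ k"
      by linarith
  qed (use \<beta>0 in auto)
  also have "\<dots> = ((n / k) powr (k / 24) * (n / k) powr (13 * k / 24)) * (exp 1 ^ k * exp 1 ^ k * exp 1 ^ k) * (1 + 3 * D * \<beta>) ^ k"
    by (simp only: power_mult_distrib mult_ac)
  also have "(n / k) powr (k / 24) * (n / k) powr (13 * k / 24) = (n / k) powr (7 * k / 12)"
    by (simp flip: powr_add)
  also have "exp 1 ^ k * exp 1 ^ k * exp 1 ^ k = (exp 3 :: real) ^ k"
    by (simp flip: power_mult_distrib exp_add)
  finally show ?thesis by (simp add: n_def power_mult_distrib mult.assoc)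
qed

end

section \<open>The upper tail\<close>

text \<open>The law of the random set enters only as a nonnegative weight with prescribed inclusion
  probabilities; the case of empty S says that the total mass is 1. Probabilities and moments are
  then finite sums over \<open>Pow V\<close>.\<close>

locale random_vertex_set = codegree_hypergraph V H D
  for V :: "'a set" and H D +
  fixes p :: real and w :: "'a set \<Rightarrow> real"
  assumes p_pos: "0 < p" and p_le: "p \<le> 1"
    and w_nonneg: "0 \<le> w A"
    and w_contains: "S \<subseteq> V \<Longrightarrow> (\<Sum>A\<in>Pow V. w A * of_bool (S \<subseteq> A)) = p ^ card S"
begin

definition edge_count :: "'a set \<Rightarrow> nat" where
  "edge_count A = card {e \<in> H. e \<subseteq> A}"

definition pr :: "('a set \<Rightarrow> bool) \<Rightarrow> real" where
  "pr Q = (\<Sum>A\<in>Pow V. w A * of_bool (Q A))"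

lemma pr_mono: "(\<And>A. A \<subseteq> V \<Longrightarrow> Q A \<Longrightarrow> Q' A) \<Longrightarrow> pr Q \<le> pr Q'"
  unfolding pr_def by (intro sum_mono mult_left_mono w_nonneg) auto

lemma pr_or: "pr (\<lambda>A. Q A \<or> Q' A) \<le> pr Q + pr Q'"
proof -
  have "w A * of_bool (Q A \<or> Q' A) \<le> w A * of_bool (Q A) + w A * of_bool (Q' A)" for A
    using w_nonneg[of A] by simp
  then show ?thesis unfolding pr_def sum.distrib[symmetric] by (rule sum_mono)
qed

lemma pr_contains: "S \<subseteq> V \<Longrightarrow> pr (\<lambda>A. S \<subseteq> A) = p ^ card S"
  unfolding pr_def by (rule w_contains)

lemma pr_ex_le:
  assumes "finite I"
  shows "pr (\<lambda>A. \<exists>i\<in>I. Q i A) \<le> (\<Sum>i\<in>I. pr (Q i))"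
  using assms
proof (induction I rule: finite_induct)
  case (insert i I)
  have "pr (\<lambda>A. \<exists>i\<in>insert i I. Q i A) = pr (\<lambda>A. Q i A \<or> (\<exists>i\<in>I. Q i A))" by simp
  also have "\<dots> \<le> pr (Q i) + pr (\<lambda>A. \<exists>i\<in>I. Q i A)" by (rule pr_or)
  finally show ?case using insert by simp
qed (simp add: pr_def)

section \<open>The mean and truncated moments of the edge count\<close>

definition \<mu> :: real where "\<mu> = card H * p ^ 3"

lemma edge_count_eq_sum: "real (edge_count A) = (\<Sum>e\<in>H. of_bool (e \<subseteq> A))"
  using finite_H by (simp add: edge_count_def of_bool_def sum.If_cases Int_def conj_commute)

text \<open>Once S is present, an edge e costs only its vertices outside S. Division by
  \<open>p ^ card S\<close> identifies \<open>planted_mean p S\<close> as a conditional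
  mean.\<close>

lemma sum_w_edge_count:
  assumes "S \<subseteq> V"
  shows "(\<Sum>A\<in>Pow V. w A * of_bool (S \<subseteq> A) * edge_count A) = p ^ card S * planted_mean p S"
proof -
  have "(\<Sum>A\<in>Pow V. w A * of_bool (S \<subseteq> A) * edge_count A)
      = (\<Sum>A\<in>Pow V. \<Sum>e\<in>H. w A * of_bool (S \<union> e \<subseteq> A))"
    unfolding edge_count_eq_sum sum_distrib_left by (intro sum.cong refl) auto
  also have "\<dots> = (\<Sum>e\<in>H. p ^ card (S \<union> e))"
    unfolding sum.swap[of _ H] by (intro sum.cong refl w_contains) (use assms edge_subset in auto)
  also have "\<dots> = (\<Sum>e\<in>H. p ^ card S * p ^ card (e - S))"
  proof (intro sum.cong refl)
    fix e assume "e \<in> H"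
    have "card (S \<union> e) = card S + card (e - S)"
      using card_Un_disjoint[of S "e - S"] assms finite_V \<open>e \<in> H\<close> finite_edge
      by (simp add: finite_subset)
    then show "p ^ card (S \<union> e) = p ^ card S * p ^ card (e - S)" by (simp add: power_add)
  qed
  finally show ?thesis by (simp add: planted_mean_def sum_distrib_left)
qed

text \<open>Truncated moments: each further factor \<open>edge_count\<close> plants one more edge, and as long as
  the planted set contains no core this multiplies the expectation by at most \<open>B\<close>.\<close>

lemma truncated_moment_le:
  fixes m B :: real
  assumes B: "0 \<le> B"
    and anti: "\<And>S T. S \<subseteq> T \<Longrightarrow> free T \<Longrightarrow> free S"
    and pm: "\<And>S. S \<subseteq> V \<Longrightarrow> free S \<Longrightarrow> card S \<le> m \<Longrightarrow> planted_mean p S \<le> B"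
    and S: "S \<subseteq> V" "card S + 3 * real l \<le> m + 3"
  shows "(\<Sum>A\<in>Pow V. w A * of_bool (free A) * of_bool (S \<subseteq> A) * real (edge_count A) ^ l) \<le> p ^ card S * B ^ l"
  using S
proof (induction l arbitrary: S)
  case 0
  have "(\<Sum>A\<in>Pow V. w A * of_bool (free A) * of_bool (S \<subseteq> A) * real (edge_count A) ^ 0)
      \<le> (\<Sum>A\<in>Pow V. w A * of_bool (S \<subseteq> A))"
    by (intro sum_mono) (simp add: w_nonneg)
  then show ?case using w_contains[OF 0(1)] by simp
next
  case (Suc l)
  show ?case
  proof (cases "free S")
    case False
    \<comment> \<open>As \<open>free\<close> passes to subsets, no free A contains S and every term
      vanishes.\<close>
    have "(\<Sum>A\<in>Pow V. w A * of_bool (free A) * of_bool (S \<subseteq> A) * real (edge_count A) ^ Suc l) = 0"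
      using False anti by (intro sum.neutral) auto
    then show ?thesis using B p_pos by simp
  next
    case True
    have "(\<Sum>A\<in>Pow V. w A * of_bool (free A) * of_bool (S \<subseteq> A) * real (edge_count A) ^ Suc l)
      = (\<Sum>A\<in>Pow V. \<Sum>e\<in>H. w A * of_bool (free A) * of_bool (S \<union> e \<subseteq> A) * real (edge_count A) ^ l)"
    proof (intro sum.cong refl)
      fix A
      have "w A * of_bool (free A) * of_bool (S \<subseteq> A) * real (edge_count A) ^ Suc l
        = (\<Sum>e\<in>H. of_bool (e \<subseteq> A)) * (w A * of_bool (free A) * of_bool (S \<subseteq> A) * real (edge_count A) ^ l)"
        by (simp add: edge_count_eq_sum[symmetric])
      also have "\<dots> = (\<Sum>e\<in>H. w A * of_bool (free A) * of_bool (S \<union> e \<subseteq> A) * real (edge_count A) ^ l)"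
        unfolding sum_distrib_right by (intro sum.cong refl) auto
      finally show "w A * of_bool (free A) * of_bool (S \<subseteq> A) * real (edge_count A) ^ Suc l = \<dots>" .
    qed
    also have "\<dots> = (\<Sum>e\<in>H. \<Sum>A\<in>Pow V. w A * of_bool (free A) * of_bool (S \<union> e \<subseteq> A) * real (edge_count A) ^ l)"
      by (rule sum.swap)
    also have "\<dots> \<le> (\<Sum>e\<in>H. p ^ card S * p ^ card (e - S) * B ^ l)"
    proof (intro sum_mono)
      fix e assume e: "e \<in> H"
      have c: "card (S \<union> e) = card S + card (e - S)"
        using card_Un_disjoint[of S "e - S"] Suc.prems finite_V e finite_edge
        by (simp add: finite_subset)
      have "card (e - S) \<le> 3" using edge_card[OF e] finite_edge[OF e] by (metis card_mono Diff_subset)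
      then have "(\<Sum>A\<in>Pow V. w A * of_bool (free A) * of_bool (S \<union> e \<subseteq> A) * real (edge_count A) ^ l)
          \<le> p ^ card (S \<union> e) * B ^ l"
        using Suc.prems edge_subset[OF e] c by (intro Suc.IH) auto
      then show "(\<Sum>A\<in>Pow V. w A * of_bool (free A) * of_bool (S \<union> e \<subseteq> A) * real (edge_count A) ^ l)
          \<le> p ^ card S * p ^ card (e - S) * B ^ l"
        by (simp add: c power_add)
    qed
    also have "\<dots> = p ^ card S * B ^ l * planted_mean p S"
      by (simp add: planted_mean_def sum_distrib_left mult_ac)
    \<comment> \<open>The size hypothesis for \<open>Suc l\<close> says that card S + 3 l \<le> m.
      In particular S has at most m vertices and the bound B on its planted mean is
      available.\<close>
    also have "\<dots> \<le> p ^ card S * B ^ l * B"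
      using pm[OF Suc.prems(1) True] Suc.prems p_pos B by (intro mult_left_mono) auto
    finally show ?thesis by (simp add: mult_ac)
  qed
qed

end

text \<open>C is the small factor in the size bound m = C \<Phi> for planted sets. Condition
  \<open>C1\<close> controls the edges with a planted vertex, \<open>C2\<close> those with two
  planted vertices and also the degree threshold 288 D of \<open>card_cores_le\<close>, and
  \<open>C3\<close> lets p^k beat the number of cores of size k.\<close>

locale upper_tail_setup = random_vertex_set +
  fixes \<epsilon> c0 C :: real
  assumes p_less: "p < 1" and eps: "0 < \<epsilon>" and c0: "0 < c0" and C: "0 < C" "C \<le> 1"
    and many_edges: "c0 * (card V)\<^sup>2 \<le> card H" and H_nonempty: "H \<noteq> {}"
    and C1: "8 * D * C \<le> \<epsilon> * sqrt c0" and C2: "2304 * D * C \<le> \<epsilon>"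
    and C3: "\<And>t::real. t \<ge> sqrt (\<epsilon> / (8 * D)) / C \<Longrightarrow>
      exp (- t / 16) * ((sqrt (\<epsilon> / (8 * D)) * sqrt c0) powr (-7/12) * exp 3 * (1 + 288 * D * D * t\<^sup>2 / \<epsilon>)) \<le> 1 / 2"
begin

section \<open>Cores, their rarity, and the resulting upper tail\<close>

definition t :: real where "t = ln (1 / p)"
definition \<Phi> :: real where "\<Phi> = min \<mu> (sqrt \<mu> * t)"
definition m :: real where "m = C * \<Phi>"
text \<open>Normalised by d m = \<epsilon>\<mu> / 8, so that in a set of at most m vertices with
  \<epsilon>\<mu> / 4 edges, passing to minimum degree d still leaves \<epsilon>\<mu> / 8
  edges.\<close>

definition d :: real where "d = \<epsilon> * \<mu> / (8 * m)"
definition c' :: real where "c' = sqrt (\<epsilon> / (8 * D))"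
definition core :: "'a set \<Rightarrow> bool" where
  "core S \<longleftrightarrow> S \<subseteq> V \<and> card S \<le> m \<and> \<epsilon> * \<mu> / 8 \<le> edge_count S \<and>
     (\<forall>v\<in>S. d \<le> card {e \<in> H. e \<subseteq> S \<and> v \<in> e})"
definition core_free :: "'a set \<Rightarrow> bool" where
  "core_free A \<longleftrightarrow> \<not> (\<exists>S\<subseteq>A. core S)"

lemma t_pos: "t > 0" and p_exp: "p = exp (- t)"
  using p_pos p_less by (auto simp: t_def ln_div)

lemma D1: "1 \<le> real D" using D_pos by simp

lemma c'_pos: "c' > 0" using eps D1 by (simp add: c'_def)

lemma \<mu>_pos: "\<mu> > 0"
  using H_nonempty finite_H p_pos by (simp add: \<mu>_def card_gt_0_iff)

lemma \<Phi>_pos: "\<Phi> > 0" using \<mu>_pos t_pos by (simp add: \<Phi>_def)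

lemma m_pos: "m > 0" using \<Phi>_pos C by (simp add: m_def)

lemma m_le: "m \<le> C * \<mu>" "m \<le> C * (sqrt \<mu> * t)"
  using C by (simp_all add: m_def \<Phi>_def)

lemma m_sq_le: "m\<^sup>2 \<le> C\<^sup>2 * (\<mu> * t\<^sup>2)"
proof -
  have "m\<^sup>2 \<le> (C * (sqrt \<mu> * t))\<^sup>2" using m_le(2) m_pos by (intro power_mono) auto
  then show ?thesis using \<mu>_pos by (simp add: power_mult_distrib)
qed

lemma d_ge: "288 * D \<le> d"
proof -
  have "288 * D * (8 * m) \<le> 288 * D * (8 * (C * \<mu>))" using m_le by (intro mult_left_mono) auto
  also have "\<dots> = 2304 * D * C * \<mu>" by simp
  also have "\<dots> \<le> \<epsilon> * \<mu>" using C2 \<mu>_pos by (intro mult_right_mono) auto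
  finally show ?thesis using m_pos by (simp add: d_def field_simps)
qed

lemma d_pos: "d > 0" using d_ge D1 by linarith

lemma sqrt_\<mu>_ge: "sqrt c0 * card V * exp (- 3 * t / 2) \<le> sqrt \<mu>"
proof -
  have "(sqrt c0 * card V * exp (- 3 * t / 2))\<^sup>2 = c0 * (card V)\<^sup>2 * exp (- 3 * t)"
    using c0 by (simp add: power_mult_distrib exp_double[symmetric])
  also have "exp (- 3 * t) = exp (- t) ^ 3" by (simp flip: exp_of_nat_mult)
  also have "exp (- t) ^ 3 = p ^ 3" by (simp only: p_exp[symmetric])
  also have "c0 * (card V)\<^sup>2 * p ^ 3 \<le> \<mu>"
    unfolding \<mu>_def using many_edges p_pos by (intro mult_right_mono) auto
  finally show ?thesis by (rule real_le_rsqrt)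
qed

lemma t_exp_le: "t * exp (- t / 2) \<le> 1" "exp (- t) * t\<^sup>2 \<le> 1"
proof -
  have "exp (t / 2) = exp (t / 4) * exp (t / 4)" by (simp flip: exp_add)
  moreover have "1 + t / 4 \<le> exp (t / 4)" by (rule exp_ge_add_one_self)
  then have "(1 + t / 4) * (1 + t / 4) \<le> exp (t / 4) * exp (t / 4)"
    using t_pos by (intro mult_mono) auto
  \<comment> \<open>The difference of the two sides is (1 - t / 4)^2.\<close>
  moreover have "t \<le> (1 + t / 4) * (1 + t / 4)"
    using zero_le_square[of "1 - t / 4"] by (simp add: algebra_simps)
  ultimately have "t \<le> exp (t / 2)" by linarith
  then show *: "t * exp (- t / 2) \<le> 1" by (simp add: exp_minus field_simps)
  have "exp (- t) * t\<^sup>2 = (t * exp (- t / 2))\<^sup>2"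
    by (simp add: power_mult_distrib exp_double[symmetric])
  also have "\<dots> \<le> 1" using * t_pos by (intro power_le_one) auto
  finally show "exp (- t) * t\<^sup>2 \<le> 1" .
qed

text \<open>A set S with more than \<epsilon>\<mu> / 4 edges would contain a core by
  \<open>min_degree_subset\<close>. The p^2 and p terms of \<open>planted_mean_le\<close> are at
  most \<epsilon>\<mu> / 8 each, and the three contributions add up to \<epsilon>\<mu> / 2.\<close>

lemma core_free_planted_mean:
  assumes S: "S \<subseteq> V" "core_free S" "card S \<le> m"
  shows "planted_mean p S \<le> (1 + \<epsilon> / 2) * \<mu>"
proof -
  have finS: "finite S" using S finite_V finite_subset by blast
  have few: "edge_count S \<le> \<epsilon> * \<mu> / 4"
  proof (rule ccontr)
    assume "\<not> ?thesis"
    moreover have "d * card S \<le> d * m" using S d_pos by (intro mult_left_mono) auto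
    moreover have "d * m = \<epsilon> * \<mu> / 8" using m_pos by (simp add: d_def)
    ultimately have "\<epsilon> * \<mu> / 8 + d * card S \<le> card {e \<in> H. e \<subseteq> S}"
      by (simp add: edge_count_def)
    then obtain T where T: "T \<subseteq> S" "\<epsilon> * \<mu> / 8 \<le> card {e \<in> H. e \<subseteq> T}"
      "\<And>v. v \<in> T \<Longrightarrow> d \<le> card {e \<in> H. e \<subseteq> T \<and> v \<in> e}"
      using min_degree_subset[OF finS less_imp_le[OF d_pos]] by blast
    moreover have "real (card T) \<le> m" using card_mono[OF finS T(1)] S(3) by linarith
    ultimately have "core T" using S(1) by (auto simp: core_def edge_count_def)
    then show False using S(2) T(1) by (auto simp: core_free_def)
  qed
  have "p\<^sup>2 * (card S * (D * card V)) \<le> p\<^sup>2 * (m * (D * card V))"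
    using S(3) unfolding of_nat_mult by (intro mult_left_mono mult_right_mono) auto
  also have "\<dots> \<le> p\<^sup>2 * (C * (sqrt \<mu> * t) * (D * card V))"
    using m_le by (intro mult_left_mono mult_right_mono) auto
  \<comment> \<open>p^2 is split as exp (- t / 2) exp (- 3 t / 2): the first factor absorbs t, and
    the second, times \<open>card V\<close>, is at most sqrt \<mu> / sqrt c0.\<close>
  also have "\<dots> = D * C * (sqrt \<mu> * (t * exp (- t / 2)) * (card V * exp (- 3 * t / 2)))"
  proof -
    have "exp (- t / 2) * exp (- 3 * t / 2) = exp (- t) * exp (- t)"
      by (simp flip: exp_add)
    then have "p\<^sup>2 = exp (- t / 2) * exp (- 3 * t / 2)"
      unfolding p_exp[symmetric] by (simp add: power2_eq_square)
    then show ?thesis by simp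
  qed
  also have "\<dots> \<le> D * C * (sqrt \<mu> * 1 * (sqrt \<mu> / sqrt c0))"
    using t_exp_le(1) sqrt_\<mu>_ge c0 C \<mu>_pos t_pos
    by (intro mult_left_mono mult_mono) (auto simp: field_simps)
  also have "\<dots> = D * C / sqrt c0 * \<mu>" using \<mu>_pos by simp
  also have "\<dots> \<le> \<epsilon> / 8 * \<mu>"
    using C1 c0 \<mu>_pos by (intro mult_right_mono) (auto simp: field_simps)
  finally have A: "p\<^sup>2 * (card S * (D * card V)) \<le> \<epsilon> / 8 * \<mu>" by simp
  have "p * (D * (card S)\<^sup>2) \<le> p * (D * m\<^sup>2)"
    using S(3) p_pos unfolding of_nat_mult of_nat_power by (intro mult_left_mono power_mono) auto
  also have "\<dots> \<le> p * (D * (C\<^sup>2 * (\<mu> * t\<^sup>2)))"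
    using m_sq_le p_pos by (intro mult_left_mono) auto
  also have "\<dots> = (D * C * \<mu>) * (C * (exp (- t) * t\<^sup>2))"
    by (simp add: p_exp[symmetric] power2_eq_square)
  also have "\<dots> \<le> (D * C * \<mu>) * (1 * 1)"
    using C t_exp_le(2) \<mu>_pos by (intro mult_left_mono mult_mono) auto
  also have "\<dots> \<le> \<epsilon> / 8 * \<mu>" using C2 D1 C \<mu>_pos eps by (simp add: mult_right_mono)
  finally have B: "p * (D * (card S)\<^sup>2) \<le> \<epsilon> / 8 * \<mu>" by simp
  have "planted_mean p S \<le> \<mu> + p\<^sup>2 * (card S * (D * card V)) + p * (D * (card S)\<^sup>2) + edge_count S"
    using planted_mean_le[OF finS, of p] p_pos p_less by (simp add: \<mu>_def edge_count_def)
  then show ?thesis using A B few by (simp add: algebra_simps)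
qed

text \<open>A core spans at least \<epsilon>\<mu> / 8 edges, whereas k vertices span at most D
  k^2.\<close>

lemma core_card_ge:
  assumes "core S" shows "c' * sqrt \<mu> \<le> card S"
proof -
  have "finite S" using assms finite_V finite_subset by (auto simp: core_def)
  from card_inside_le[OF this] have "real (edge_count S) \<le> D * (card S)\<^sup>2"
    unfolding edge_count_def by (simp only: of_nat_le_iff)
  then have "\<epsilon> * \<mu> / 8 \<le> D * (card S)\<^sup>2" using assms by (simp add: core_def)
  then have "(c' * sqrt \<mu>)\<^sup>2 \<le> (real (card S))\<^sup>2"
    using eps D1 \<mu>_pos by (simp add: c'_def power_mult_distrib field_simps)
  then show ?thesis by (rule power2_le_imp_le) simp
qed

text \<open>The number of cores grows with t only like exp (7 t k / 8) times a polynomial factor to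
  the power k, against p^k = exp (- t k). Half of the surplus exp (- t k / 8) pays for the remaining
  factors and for 2^(-k), the other half for the exponential in \<Phi>.\<close>

lemma cores_of_size_weight:
  fixes k :: nat
  assumes k: "c' * sqrt \<mu> \<le> k" "k \<le> m" "k \<le> card V"
  shows "card {S. core S \<and> card S = k} * p ^ k \<le> exp (- (c' / 16) * \<Phi>) * (1 / 2) ^ k"
proof -
  define q where "q = c' * sqrt c0"
  \<comment> \<open>Chosen so that \<beta> d = 12 D \<mu> t^2 / m, which is at least 12 D m because
    m^2 \<le> \<mu> t^2.\<close>
  define \<beta> where "\<beta> = 96 * D * t\<^sup>2 / \<epsilon>"
  have q: "q > 0" using c'_pos c0 by (simp add: q_def)
  have "0 < c' * sqrt \<mu>" using c'_pos \<mu>_pos by simp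
  then have k0: "0 < k" using k(1) by linarith
  \<comment> \<open>A size k in the stated range forces c' sqrt \<mu> \<le> C t sqrt \<mu>. Cores
    can thus occur only when t is at least c' / C, which is the range of \<open>C3\<close>.\<close>
  have "c' * sqrt \<mu> \<le> C * t * sqrt \<mu>" using k m_le(2) by (simp add: mult_ac)
  then have "c' \<le> C * t" using \<mu>_pos by simp
  then have tlarge: "c' / C \<le> t" using C by (simp add: field_simps)
  have "12 * D * real k \<le> 12 * D * m" using k by (intro mult_left_mono) auto
  also have "\<dots> \<le> \<beta> * d"
  proof -
    have "m * m \<le> C\<^sup>2 * (\<mu> * t\<^sup>2)" using m_sq_le by (simp add: power2_eq_square)
    also have "\<dots> \<le> 1 * (\<mu> * t\<^sup>2)" using C \<mu>_pos by (intro mult_right_mono power_le_one) auto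
    finally have "m * m \<le> \<mu> * t\<^sup>2" by simp
    then have "m \<le> \<mu> * t\<^sup>2 / m" using m_pos by (simp add: field_simps)
    then have "12 * D * m \<le> 12 * D * (\<mu> * t\<^sup>2 / m)" by (intro mult_left_mono) auto
    then show ?thesis using eps by (simp add: \<beta>_def d_def)
  qed
  finally have \<beta>: "12 * D * real k \<le> \<beta> * d" by simp
  have \<beta>0: "\<beta> \<ge> 0" using eps by (simp add: \<beta>_def)
  have "{S. core S \<and> card S = k}
      \<subseteq> {S. S \<subseteq> V \<and> card S = k \<and> (\<forall>v\<in>S. d \<le> card {e \<in> H. e \<subseteq> S \<and> v \<in> e})}"
    by (auto simp: core_def)
  then have "card {S. core S \<and> card S = k}
      \<le> card {S. S \<subseteq> V \<and> card S = k \<and> (\<forall>v\<in>S. d \<le> card {e \<in> H. e \<subseteq> S \<and> v \<in> e})}"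
    using finite_V by (intro card_mono) auto
  then have "real (card {S. core S \<and> card S = k})
      \<le> card {S. S \<subseteq> V \<and> card S = k \<and> (\<forall>v\<in>S. d \<le> card {e \<in> H. e \<subseteq> S \<and> v \<in> e})}"
    by (simp only: of_nat_le_iff)
  also have "\<dots> \<le> (card V / k) powr (7 * k / 12) * (exp 3 * (1 + 3 * D * \<beta>)) ^ k"
    using card_cores_le[OF k0 d_ge \<beta> k(3)] by simp
  \<comment> \<open>As k \<ge> c' sqrt \<mu> and sqrt \<mu> is at least sqrt c0 exp (- 3 t / 2)
    \<open>card V\<close>, the ratio is at most exp (3 t / 2) / q. The exponent of t per vertex
    becomes (3 / 2) (7 / 12) = 7 / 8.\<close>
  also have "(card V / k) powr (7 * k / 12) \<le> (exp (3 * t / 2) / q) powr (7 * k / 12)"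
  proof (rule powr_mono2)
    have "sqrt c0 * card V * exp (- 3 * t / 2) * c' \<le> sqrt \<mu> * c'"
      using sqrt_\<mu>_ge c'_pos by (intro mult_right_mono) auto
    also have "\<dots> \<le> k" using k by (simp add: mult.commute)
    finally have "q * card V * exp (- 3 * t / 2) \<le> k" by (simp add: q_def mult_ac)
    then have "q * card V \<le> k * exp (3 * t / 2)"
      by (simp add: exp_minus field_simps)
    then show "card V / k \<le> exp (3 * t / 2) / q" using q k0 by (simp add: field_simps)
  qed auto
  also have "(exp (3 * t / 2) / q) powr (7 * k / 12) = (exp (7 * t / 8) * q powr (-7/12)) ^ k"
  proof -
    have "(exp (3 * t / 2) / q) powr (7 * k / 12) = ((exp (3 * t / 2) / q) powr (7 / 12)) powr k"
      by (simp add: powr_powr)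
    also have "\<dots> = ((exp (3 * t / 2) / q) powr (7 / 12)) ^ k"
      using q by (simp add: powr_realpow)
    also have "(exp (3 * t / 2) / q) powr (7 / 12) = exp (7 * t / 8) * q powr (-7/12)"
      using q by (simp add: powr_divide powr_minus_divide exp_powr_real)
    finally show ?thesis .
  qed
  finally have "real (card {S. core S \<and> card S = k}) * p ^ k
     \<le> (exp (7 * t / 8) * q powr (-7/12)) ^ k * (exp 3 * (1 + 3 * D * \<beta>)) ^ k * p ^ k"
    using \<beta>0 p_pos by (simp add: mult_right_mono)
  also have "\<dots> = ((exp (7 * t / 8) * p) * (q powr (-7/12) * exp 3 * (1 + 3 * D * \<beta>))) ^ k"
    by (simp add: power_mult_distrib mult_ac)
  also have "\<dots> \<le> (exp (- t / 16) * (1 / 2)) ^ k"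
  proof (rule power_mono)
    have "exp (7 * t / 8) * exp (- t) = exp (- t / 16) * exp (- t / 16)"
      by (simp flip: exp_add)
    then have "exp (7 * t / 8) * p = exp (- t / 16) * exp (- t / 16)"
      unfolding p_exp[symmetric] .
    moreover have "exp (- t / 16) * (q powr (-7/12) * exp 3 * (1 + 3 * D * \<beta>)) \<le> 1 / 2"
    proof -
      have "3 * D * \<beta> = 288 * D * D * t\<^sup>2 / \<epsilon>" by (simp add: \<beta>_def)
      then show ?thesis using C3[of t] tlarge by (simp only: q_def c'_def of_nat_mult of_nat_numeral)
    qed
    ultimately show "exp (7 * t / 8) * p * (q powr (-7/12) * exp 3 * (1 + 3 * D * \<beta>)) \<le> exp (- t / 16) * (1 / 2)"
      by (simp add: mult.assoc)
    show "0 \<le> exp (7 * t / 8) * p * (q powr (-7/12) * exp 3 * (1 + 3 * D * \<beta>))"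
      using \<beta>0 p_pos by simp
  qed
  also have "\<dots> = exp (- t / 16 * k) * (1 / 2) ^ k"
    unfolding power_mult_distrib by (simp add: exp_of_nat_mult[symmetric] mult_ac)
  also have "\<dots> \<le> exp (- (c' / 16) * \<Phi>) * (1 / 2) ^ k"
  proof -
    have "c' * \<Phi> \<le> c' * (sqrt \<mu> * t)" using c'_pos by (simp add: \<Phi>_def)
    also have "\<dots> \<le> k * t" using k(1) t_pos by (simp add: mult.assoc[symmetric] mult_right_mono)
    finally show ?thesis by (intro mult_right_mono) (auto simp: mult_ac)
  qed
  finally show ?thesis .
qed

text \<open>A union bound over the cores grouped by size. Core sizes are positive, so the factors
  2^(-k) sum to at most 1.\<close>

lemma pr_core: "pr (\<lambda>A. \<exists>S\<subseteq>A. core S) \<le> exp (- (c' / 16) * \<Phi>)"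
proof -
  have fin: "finite {S. core S}"
    using finite_V by (rule_tac finite_subset[of _ "Pow V"]) (auto simp: core_def)
  define K where "K = card ` {S. core S}"
  have K: "finite K" using fin by (simp add: K_def)
  have kK: "c' * sqrt \<mu> \<le> k \<and> k \<le> m \<and> k \<le> card V \<and> k > 0" if "k \<in> K" for k
  proof -
    obtain S where S: "core S" "k = card S" using \<open>k \<in> K\<close> by (auto simp: K_def)
    have "0 < c' * sqrt \<mu>" using c'_pos \<mu>_pos by simp
    then have "0 < real k" using core_card_ge[OF S(1)] S(2) by linarith
    then show ?thesis
      using core_card_ge[OF S(1)] S finite_V by (auto simp: core_def intro: card_mono)
  qed
  have "pr (\<lambda>A. \<exists>S\<subseteq>A. core S) = pr (\<lambda>A. \<exists>S\<in>{S. core S}. S \<subseteq> A)"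
    by (simp add: conj_commute Bex_def)
  also have "\<dots> \<le> (\<Sum>S | core S. pr (\<lambda>A. S \<subseteq> A))"
    by (rule pr_ex_le[OF fin])
  also have "\<dots> = (\<Sum>S | core S. p ^ card S)"
    by (intro sum.cong refl pr_contains) (auto simp: core_def)
  also have "\<dots> = (\<Sum>k\<in>K. \<Sum>S | S \<in> {S. core S} \<and> card S = k. p ^ card S)"
    unfolding K_def by (rule sum.image_gen[OF fin])
  also have "\<dots> = (\<Sum>k\<in>K. card {S. core S \<and> card S = k} * p ^ k)"
    by (intro sum.cong refl) simp
  also have "\<dots> \<le> (\<Sum>k\<in>K. exp (- (c' / 16) * \<Phi>) * (1 / 2) ^ k)"
    using kK by (intro sum_mono cores_of_size_weight) auto
  also have "\<dots> = exp (- (c' / 16) * \<Phi>) * (\<Sum>k\<in>K. (1 / 2) ^ k)"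
    by (simp add: sum_distrib_left)
  also have "\<dots> \<le> exp (- (c' / 16) * \<Phi>) * 1"
  proof (intro mult_left_mono)
    have "(\<Sum>k\<in>K. (1 / 2 :: real) ^ k) \<le> (\<Sum>k\<in>Suc ` {..<card V}. (1 / 2) ^ k)"
    proof (rule sum_mono2)
      show "K \<subseteq> Suc ` {..<card V}"
      proof
        fix k assume "k \<in> K"
        from kK[OF this] show "k \<in> Suc ` {..<card V}"
          by (intro image_eqI[of _ _ "k - 1"]) auto
      qed
    qed auto
    also have "\<dots> = (\<Sum>k<card V. (1 / 2) ^ Suc k)" by (simp add: sum.reindex)
    also have "\<dots> = (1 / 2) * (\<Sum>k<card V. (1 / 2) ^ k)" by (simp add: sum_distrib_left)
    also have "\<dots> \<le> 1" by (simp add: sum_gp_strict)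
    finally show "(\<Sum>k\<in>K. (1 / 2 :: real) ^ k) \<le> 1" .
  qed auto
  finally show ?thesis by simp
qed

text \<open>Either the random set contains a core, or it is core-free and Markov's inequality for
  the truncated moment of order l gives ((1 + \<epsilon> / 2) / (1 + \<epsilon>))^l.\<close>

lemma upper_tail:
  "pr (\<lambda>A. (1 + \<epsilon>) * \<mu> \<le> edge_count A)
     \<le> exp (- (c' / 16) * \<Phi>) + exp (- (ln ((1 + \<epsilon>) / (1 + \<epsilon> / 2)) * C / 3) * \<Phi>)"
proof -
  \<comment> \<open>The largest order with 3 l \<le> m + 3, as \<open>truncated_moment_le\<close>
    requires for the empty planted set; it still satisfies l \<ge> m / 3.\<close>
  define l where "l = nat \<lfloor>m / 3\<rfloor> + 1"
  define a where "a = (1 + \<epsilon>) * \<mu>"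
  define B where "B = (1 + \<epsilon> / 2) * \<mu>"
  have a: "a > 0" and B: "B > 0" using eps \<mu>_pos by (simp_all add: a_def B_def)
  have "real (nat \<lfloor>m / 3\<rfloor>) \<le> m / 3"
    using m_pos of_int_floor_le[of "m / 3"] by simp
  then have l1: "3 * real l \<le> m + 3" by (simp add: l_def)
  have "m / 3 < real_of_int \<lfloor>m / 3\<rfloor> + 1" by linarith
  moreover have "real l = real_of_int \<lfloor>m / 3\<rfloor> + 1" using m_pos by (simp add: l_def)
  ultimately have l2: "m / 3 \<le> l" by linarith
  have "pr (\<lambda>A. core_free A \<and> a \<le> edge_count A)
      \<le> (\<Sum>A\<in>Pow V. w A * of_bool (core_free A) * of_bool ({} \<subseteq> A) * real (edge_count A) ^ l / a ^ l)"
    unfolding pr_def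
  proof (rule sum_mono)
    fix A
    have "of_bool (core_free A \<and> a \<le> edge_count A) \<le> of_bool (core_free A) * (real (edge_count A) ^ l / a ^ l)"
      using a by (auto simp: field_simps intro!: power_mono)
    from mult_left_mono[OF this w_nonneg[of A]]
    show "w A * of_bool (core_free A \<and> a \<le> edge_count A)
      \<le> w A * of_bool (core_free A) * of_bool ({} \<subseteq> A) * real (edge_count A) ^ l / a ^ l"
      by simp
  qed
  also have "\<dots> = (\<Sum>A\<in>Pow V. w A * of_bool (core_free A) * of_bool ({} \<subseteq> A) * real (edge_count A) ^ l) / a ^ l"
    by (simp add: sum_divide_distrib)
  also have "\<dots> \<le> (p ^ card ({} :: 'a set) * B ^ l) / a ^ l"
  proof (intro divide_right_mono truncated_moment_le[where m = m])
    show "core_free S" if "S \<subseteq> T" "core_free T" for S T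
      using that by (auto simp: core_free_def)
    show "planted_mean p S \<le> B" if "S \<subseteq> V" "core_free S" "card S \<le> m" for S
      unfolding B_def by (rule core_free_planted_mean[OF that])
  qed (use a B l1 in auto)
  also have "\<dots> = ((1 + \<epsilon> / 2) / (1 + \<epsilon>)) ^ l"
    using \<mu>_pos by (simp add: a_def B_def power_divide power_mult_distrib)
  also have "\<dots> = exp (- ln ((1 + \<epsilon>) / (1 + \<epsilon> / 2)) * l)"
  proof -
    have "exp (- ln ((1 + \<epsilon>) / (1 + \<epsilon> / 2))) = (1 + \<epsilon> / 2) / (1 + \<epsilon>)"
      using eps by (simp add: exp_minus)
    then show ?thesis by (metis exp_of_nat2_mult)
  qed
  also have "\<dots> \<le> exp (- (ln ((1 + \<epsilon>) / (1 + \<epsilon> / 2)) * C / 3) * \<Phi>)"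
  proof -
    have "ln ((1 + \<epsilon>) / (1 + \<epsilon> / 2)) \<ge> 0" using eps by (intro ln_ge_zero) (simp add: field_simps)
    from mult_left_mono[OF l2 this] show ?thesis by (simp add: m_def mult_ac)
  qed
  finally have "pr (\<lambda>A. core_free A \<and> a \<le> edge_count A) \<le> exp (- (ln ((1 + \<epsilon>) / (1 + \<epsilon> / 2)) * C / 3) * \<Phi>)" .
  moreover have "pr (\<lambda>A. a \<le> edge_count A) \<le> pr (\<lambda>A. (\<exists>S\<subseteq>A. core S) \<or> (core_free A \<and> a \<le> edge_count A))"
    by (rule pr_mono) (auto simp: core_free_def)
  moreover have "\<dots> \<le> pr (\<lambda>A. \<exists>S\<subseteq>A. core S) + pr (\<lambda>A. core_free A \<and> a \<le> edge_count A)"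
    by (rule pr_or)
  ultimately show ?thesis using pr_core by (simp add: a_def)
qed

end

section \<open>The lower bound in the Poisson regime\<close>

context codegree_hypergraph
begin

text \<open>The bad choices for the next planted edge. Any other edge adds three vertices and
  exactly one edge, which keeps the falling factorial in step with the number of planted
  edges.\<close>

definition interfering :: "'a set \<Rightarrow> 'a set set" where
  "interfering S = {e \<in> H. e \<inter> S \<noteq> {} \<or> (\<exists>f\<in>H. f \<subseteq> S \<union> e \<and> \<not> f \<subseteq> S \<and> f \<noteq> e)}"

text \<open>An interfering edge e meets S (\<open>E1\<close>), or creates an edge f with two
  vertices in S, hence shares a vertex with f (\<open>E2\<close>), or creates an edge f with one
  vertex in S, hence contains the other two (\<open>E3\<close>). Counting f first and then e gives
  terms with coefficients 1, 3 and 9, whence 13.\<close>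

lemma card_interfering_le:
  assumes finS: "finite S"
  shows "card (interfering S) \<le> 13 * D\<^sup>2 * (card S)\<^sup>2 * card V"
proof -
  define n where "n = card V"
  define s where "s = card S"
  define E1 where "E1 = {e \<in> H. e \<inter> S \<noteq> {}}"
  define E2 where "E2 = (\<Union>f\<in>{f \<in> H. two_in S f}. \<Union>v\<in>f. {e \<in> H. v \<in> e})"
  define E3 where "E3 = (\<Union>f\<in>{f \<in> H. f \<inter> S \<noteq> {}}. \<Union>b\<in>f. \<Union>c\<in>f - {b}. {e \<in> H. b \<in> e \<and> c \<in> e})"
  have "interfering S \<subseteq> E1 \<union> E2 \<union> E3"
  proof
    fix e assume "e \<in> interfering S"
    then have e: "e \<in> H" and alt: "e \<inter> S \<noteq> {} \<or> (\<exists>f\<in>H. f \<subseteq> S \<union> e \<and> \<not> f \<subseteq> S \<and> f \<noteq> e)"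
      by (auto simp: interfering_def)
    show "e \<in> E1 \<union> E2 \<union> E3"
    proof (cases "e \<inter> S = {}")
      case False then show ?thesis using e by (simp add: E1_def)
    next
      case disj: True
      then obtain f where f: "f \<in> H" "f \<subseteq> S \<union> e" "\<not> f \<subseteq> S" "f \<noteq> e" using alt by blast
      \<comment> \<open>An edge f disjoint from S would lie inside e, and both have three
        vertices.\<close>
      have meets: "f \<inter> S \<noteq> {}"
      proof
        assume "f \<inter> S = {}"
        then have "f \<subseteq> e" using f by auto
        then have "f = e" using card_subset_eq[OF finite_edge[OF e]] edge_card e f by simp
        with f show False by simp
      qed
      show ?thesis
      proof (cases "two_in S f")
        case True
        obtain v where "v \<in> f" "v \<in> e" using f by auto
        then have "e \<in> E2" unfolding E2_def using True f e by auto
        then show ?thesis by simp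
      next
        case False
        obtain v where v: "v \<in> f" "v \<in> S" using meets by auto
        have "card (f - {v}) = 2" using edge_card[OF f(1)] v finite_edge[OF f(1)] by simp
        then obtain b c where bc: "f - {v} = {b, c}" "b \<noteq> c" by (auto simp: card_2_iff)
        then have bcf: "b \<in> f" "c \<in> f" "b \<noteq> v" "c \<noteq> v" by auto
        then have "b \<notin> S" "c \<notin> S" using False v unfolding two_in_def by auto
        then have "b \<in> e" "c \<in> e" using bcf f by auto
        then have "e \<in> E3" unfolding E3_def using f e bc(2) bcf meets by auto
        then show ?thesis by simp
      qed
    qed
  qed
  then have "card (interfering S) \<le> card (E1 \<union> E2 \<union> E3)"
    by (rule card_mono[rotated]) (auto simp: E1_def E2_def E3_def finite_H finite_edge)
  also have "\<dots> \<le> card E1 + card E2 + card E3"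
    by (meson add_le_mono1 card_Un_le order_trans)
  also have "card E1 \<le> s * (D * n)"
    unfolding E1_def s_def n_def by (rule card_touching_le[OF finS])
  also have "card E2 \<le> D * s\<^sup>2 * (3 * (D * n))"
  proof -
    have "card E2 \<le> (\<Sum>f\<in>{f \<in> H. two_in S f}. card (\<Union>v\<in>f. {e \<in> H. v \<in> e}))"
      unfolding E2_def using finite_H by (intro card_UN_le) auto
    also have "\<dots> \<le> (\<Sum>f\<in>{f \<in> H. two_in S f}. 3 * (D * n))"
    proof (intro sum_mono)
      fix f assume "f \<in> {f \<in> H. two_in S f}"
      then have f: "f \<in> H" by simp
      have "card (\<Union>v\<in>f. {e \<in> H. v \<in> e}) \<le> (\<Sum>v\<in>f. card {e \<in> H. v \<in> e})"
        by (rule card_UN_le[OF finite_edge[OF f]])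
      also have "\<dots> \<le> (\<Sum>v\<in>f. D * n)" unfolding n_def by (intro sum_mono degree_le)
      finally show "card (\<Union>v\<in>f. {e \<in> H. v \<in> e}) \<le> 3 * (D * n)" by (simp add: edge_card[OF f])
    qed
    also have "\<dots> = card {f \<in> H. two_in S f} * (3 * (D * n))" by simp
    also have "\<dots> \<le> D * s\<^sup>2 * (3 * (D * n))"
      unfolding s_def by (intro mult_right_mono card_two_in_le finS) auto
    finally show ?thesis .
  qed
  also have "card E3 \<le> s * (D * n) * (9 * D)"
  proof -
    have "card E3 \<le> (\<Sum>f\<in>{f \<in> H. f \<inter> S \<noteq> {}}. card (\<Union>b\<in>f. \<Union>c\<in>f - {b}. {e \<in> H. b \<in> e \<and> c \<in> e}))"
      unfolding E3_def using finite_H by (intro card_UN_le) auto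
    also have "\<dots> \<le> (\<Sum>f\<in>{f \<in> H. f \<inter> S \<noteq> {}}. 9 * D)"
    proof (intro sum_mono)
      fix f assume "f \<in> {f \<in> H. f \<inter> S \<noteq> {}}"
      then have f: "f \<in> H" by simp
      have "card (\<Union>b\<in>f. \<Union>c\<in>f - {b}. {e \<in> H. b \<in> e \<and> c \<in> e})
          \<le> (\<Sum>b\<in>f. card (\<Union>c\<in>f - {b}. {e \<in> H. b \<in> e \<and> c \<in> e}))"
        by (rule card_UN_le[OF finite_edge[OF f]])
      also have "\<dots> \<le> (\<Sum>b\<in>f. \<Sum>c\<in>f - {b}. card {e \<in> H. b \<in> e \<and> c \<in> e})"
        by (intro sum_mono card_UN_le) (simp add: finite_edge[OF f])
      also have "\<dots> \<le> (\<Sum>b\<in>f. \<Sum>c\<in>f - {b}. D)"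
        by (intro sum_mono codegree) auto
      also have "\<dots> \<le> (\<Sum>b\<in>f. 3 * D)"
      proof (intro sum_mono)
        fix b
        have "card (f - {b}) \<le> 3" using card_mono[OF finite_edge[OF f], of "f - {b}"] edge_card[OF f] by auto
        then show "(\<Sum>c\<in>f - {b}. D) \<le> 3 * D" by simp
      qed
      also have "\<dots> = 9 * D" using edge_card[OF f] by simp
      finally show "card (\<Union>b\<in>f. \<Union>c\<in>f - {b}. {e \<in> H. b \<in> e \<and> c \<in> e}) \<le> 9 * D" .
    qed
    also have "\<dots> = card {f \<in> H. f \<inter> S \<noteq> {}} * (9 * D)" by simp
    also have "\<dots> \<le> s * (D * n) * (9 * D)"
      unfolding s_def n_def by (intro mult_right_mono card_touching_le finS) auto
    finally show ?thesis .
  qed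
  also have "s * (D * n) + D * s\<^sup>2 * (3 * (D * n)) + s * (D * n) * (9 * D) \<le> 13 * D\<^sup>2 * s\<^sup>2 * n"
  proof -
    have "s \<le> s\<^sup>2" "D \<le> D\<^sup>2" by (simp_all add: power2_eq_square)
    then have "D * s \<le> D\<^sup>2 * s\<^sup>2" "D\<^sup>2 * s \<le> D\<^sup>2 * s\<^sup>2" by (simp_all add: mult_le_mono)
    then have "D * s * n \<le> D\<^sup>2 * s\<^sup>2 * n" "D\<^sup>2 * s * n \<le> D\<^sup>2 * s\<^sup>2 * n" by (simp_all add: mult_le_mono1)
    moreover have "s * (D * n) + D * s\<^sup>2 * (3 * (D * n)) + s * (D * n) * (9 * D)
        = D * s * n + 3 * (D\<^sup>2 * s\<^sup>2 * n) + 9 * (D\<^sup>2 * s * n)"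
      by (simp add: power2_eq_square)
    moreover have "13 * D\<^sup>2 * s\<^sup>2 * n = 13 * (D\<^sup>2 * s\<^sup>2 * n)" by simp
    ultimately show ?thesis by linarith
  qed
  finally show ?thesis by (simp add: s_def n_def)
qed

end

section \<open>Planting a matching: lower bounds from a truncated factorial moment\<close>

context random_vertex_set
begin

lemma edge_count_not_interfering:
  assumes "S \<subseteq> V" "e \<in> H - interfering S"
  shows "edge_count (S \<union> e) = edge_count S + 1" "card (S \<union> e) = card S + 3" "\<not> e \<subseteq> S"
proof -
  have e: "e \<in> H" "e \<inter> S = {}" and other: "\<And>f. f \<in> H \<Longrightarrow> f \<subseteq> S \<union> e \<Longrightarrow> f \<subseteq> S \<or> f = e"
    using assms by (auto simp: interfering_def)
  show ne: "\<not> e \<subseteq> S"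
  proof
    assume "e \<subseteq> S"
    then have "e = {}" using e by auto
    then show False using edge_card[OF e(1)] by simp
  qed
  have "{f \<in> H. f \<subseteq> S \<union> e} = insert e {f \<in> H. f \<subseteq> S}" using other e by auto
  then show "edge_count (S \<union> e) = edge_count S + 1"
    using ne finite_H by (simp add: edge_count_def)
  show "card (S \<union> e) = card S + 3"
    using card_Un_disjoint[of S e] e assms finite_V finite_edge edge_card
    by (simp add: finite_subset Int_commute)
qed

text \<open>Planting \<open>l\<close> further edges one at a time, each chosen so that it creates no other edge.
  The product is the falling factorial that counts the ways to continue.\<close>

lemma planted_matching_moment:
  fixes m :: nat and T :: real
  assumes T: "T > 0"
    and few: "\<And>S. S \<subseteq> V \<Longrightarrow> card S \<le> 3 * m \<Longrightarrow> 2 * card (interfering S) \<le> card H"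
    and pm: "\<And>S. S \<subseteq> V \<Longrightarrow> card S = 3 * m \<Longrightarrow> edge_count S = m \<Longrightarrow> planted_mean p S \<le> T / 2"
    and S: "S \<subseteq> V" "l \<le> m" "card S = 3 * (m - l)" "edge_count S = m - l"
  shows "(card H / 2) ^ l * (p ^ (3 * m) / 2)
    \<le> (\<Sum>A\<in>Pow V. w A * of_bool (S \<subseteq> A \<and> edge_count A \<le> T) * (\<Prod>j\<in>{m - l..<m}. real (edge_count A - j)))"
  using S
proof (induction l arbitrary: S)
  case 0
  \<comment> \<open>Conditional Markov inequality: given S, the mean is at most T / 2, so the edge
    count exceeds T with probability at most 1 / 2.\<close>
  have "p ^ card S * (1 / 2) \<le> p ^ card S * (1 - planted_mean p S / T)"
    using pm[of S] 0 T p_pos by (intro mult_left_mono) (auto simp: field_simps)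
  also have "\<dots> = (\<Sum>A\<in>Pow V. w A * of_bool (S \<subseteq> A)) - (\<Sum>A\<in>Pow V. w A * of_bool (S \<subseteq> A) * edge_count A) / T"
    using w_contains[OF 0(1)] sum_w_edge_count[OF 0(1)] by (simp add: algebra_simps)
  also have "\<dots> = (\<Sum>A\<in>Pow V. w A * of_bool (S \<subseteq> A) * (1 - edge_count A / T))"
    by (simp add: sum_divide_distrib sum_subtractf[symmetric] algebra_simps)
  also have "\<dots> \<le> (\<Sum>A\<in>Pow V. w A * of_bool (S \<subseteq> A \<and> edge_count A \<le> T))"
  proof (rule sum_mono)
    fix A
    have "of_bool (S \<subseteq> A) * (1 - edge_count A / T) \<le> of_bool (S \<subseteq> A \<and> edge_count A \<le> T)"
      using T by (auto simp: field_simps)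
    from mult_left_mono[OF this w_nonneg[of A]]
    show "w A * of_bool (S \<subseteq> A) * (1 - edge_count A / T) \<le> w A * of_bool (S \<subseteq> A \<and> edge_count A \<le> T)"
      by simp
  qed
  finally show ?case using 0 by simp
next
  case (Suc l)
  define P where "P A = (\<Prod>j\<in>{m - l..<m}. real (edge_count A - j))" for A
  define N where "N = {e \<in> H. \<not> e \<subseteq> S}"
  have finS: "finite S" using Suc.prems finite_V finite_subset by blast
  have good: "real (card H) / 2 \<le> card (H - interfering S)"
  proof -
    have "card S \<le> 3 * m" using Suc.prems by simp
    then have "2 * card (interfering S) \<le> card H" using few Suc.prems by blast
    moreover have "card (H - interfering S) = card H - card (interfering S)"
      using finite_H by (intro card_Diff_subset) (auto simp: interfering_def intro: finite_subset)
    ultimately show ?thesis by linarith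
  qed
  have "(card H / 2) ^ Suc l * (p ^ (3 * m) / 2) = (card H / 2) * ((card H / 2) ^ l * (p ^ (3 * m) / 2))"
    by simp
  also have "\<dots> \<le> card (H - interfering S) * ((card H / 2) ^ l * (p ^ (3 * m) / 2))"
    using good p_pos by (intro mult_right_mono) auto
  also have "\<dots> = (\<Sum>e\<in>H - interfering S. (card H / 2) ^ l * (p ^ (3 * m) / 2))"
    by simp
  also have "\<dots> \<le> (\<Sum>e\<in>H - interfering S. \<Sum>A\<in>Pow V. w A * of_bool (S \<union> e \<subseteq> A \<and> edge_count A \<le> T) * P A)"
  proof (intro sum_mono)
    fix e assume e: "e \<in> H - interfering S"
    note E = edge_count_not_interfering[OF Suc.prems(1) e]
    show "(card H / 2) ^ l * (p ^ (3 * m) / 2)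
        \<le> (\<Sum>A\<in>Pow V. w A * of_bool (S \<union> e \<subseteq> A \<and> edge_count A \<le> T) * P A)"
      unfolding P_def using Suc.prems E e edge_subset by (intro Suc.IH) auto
  qed
  \<comment> \<open>Passing from the non-interfering edges to all edges not inside S makes the count
    exact: A contains \<open>edge_count A - (m - Suc l)\<close> of them, which is the next factor of
    the falling factorial.\<close>
  also have "\<dots> \<le> (\<Sum>e\<in>N. \<Sum>A\<in>Pow V. w A * of_bool (S \<union> e \<subseteq> A \<and> edge_count A \<le> T) * P A)"
  proof (rule sum_mono2)
    show "finite N" using finite_H by (simp add: N_def)
    show "H - interfering S \<subseteq> N"
      using edge_count_not_interfering(3)[OF Suc.prems(1)] by (auto simp: N_def)
    show "0 \<le> (\<Sum>A\<in>Pow V. w A * of_bool (S \<union> e \<subseteq> A \<and> edge_count A \<le> T) * P A)" for e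
      by (intro sum_nonneg mult_nonneg_nonneg w_nonneg) (auto simp: P_def prod_nonneg)
  qed
  also have "\<dots> = (\<Sum>A\<in>Pow V. \<Sum>e\<in>N. w A * of_bool (S \<union> e \<subseteq> A \<and> edge_count A \<le> T) * P A)"
    by (rule sum.swap)
  also have "\<dots> = (\<Sum>A\<in>Pow V. w A * of_bool (S \<subseteq> A \<and> edge_count A \<le> T) *
      (\<Prod>j\<in>{m - Suc l..<m}. real (edge_count A - j)))"
  proof (intro sum.cong refl)
    fix A
    show "(\<Sum>e\<in>N. w A * of_bool (S \<union> e \<subseteq> A \<and> edge_count A \<le> T) * P A) =
       w A * of_bool (S \<subseteq> A \<and> edge_count A \<le> T) * (\<Prod>j\<in>{m - Suc l..<m}. real (edge_count A - j))"
    proof (cases "S \<subseteq> A \<and> edge_count A \<le> T")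
      case True
      have "(\<Sum>e\<in>N. of_bool (e \<subseteq> A)) = real (card {e \<in> N. e \<subseteq> A})"
        using finite_H by (simp add: N_def of_bool_def sum.If_cases Int_def conj_commute)
      also have "{e \<in> N. e \<subseteq> A} = {e \<in> H. e \<subseteq> A} - {e \<in> H. e \<subseteq> S}"
        by (auto simp: N_def)
      also have "card \<dots> = edge_count A - edge_count S"
        unfolding edge_count_def using finite_H True by (intro card_Diff_subset) auto
      also have "edge_count S = m - Suc l" using Suc.prems by simp
      finally have "(\<Sum>e\<in>N. of_bool (e \<subseteq> A)) = real (edge_count A - (m - Suc l))" .
      moreover have "{m - Suc l..<m} = insert (m - Suc l) {m - l..<m}" using Suc.prems by auto
      then have "(\<Prod>j\<in>{m - Suc l..<m}. real (edge_count A - j)) = real (edge_count A - (m - Suc l)) * P A"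
        using Suc.prems by (simp add: P_def)
      moreover have "(\<Sum>e\<in>N. w A * of_bool (S \<union> e \<subseteq> A \<and> edge_count A \<le> T) * P A)
          = (\<Sum>e\<in>N. of_bool (e \<subseteq> A)) * (w A * P A)"
        unfolding sum_distrib_right using True by (intro sum.cong refl) auto
      ultimately show ?thesis using True by (simp add: mult_ac)
    next
      case False
      then have "\<not> (S \<union> e \<subseteq> A \<and> edge_count A \<le> T)" for e by auto
      then show ?thesis using False by (simp only: of_bool_eq mult_zero_right mult_zero_left sum.neutral_const)
    qed
  qed
  finally show ?case .
qed

text \<open>On the event that there are at most T edges, the falling factorial is at most T^m, and
  it vanishes when there are fewer than m edges. Dividing the moment bound by T^m therefore bounds a
  probability.\<close>

lemma planted_matching_lower:
  fixes m :: nat and T :: real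
  assumes T: "T > 0"
    and few: "\<And>S. S \<subseteq> V \<Longrightarrow> card S \<le> 3 * m \<Longrightarrow> 2 * card (interfering S) \<le> card H"
    and pm: "\<And>S. S \<subseteq> V \<Longrightarrow> card S = 3 * m \<Longrightarrow> edge_count S = m \<Longrightarrow> planted_mean p S \<le> T / 2"
  shows "(\<mu> / (2 * T)) ^ m / 2 \<le> pr (\<lambda>A. m \<le> edge_count A)"
proof -
  have "edge_count {} = 0"
    using edge_card by (fastforce simp: edge_count_def)
  then have "(card H / 2) ^ m * (p ^ (3 * m) / 2)
    \<le> (\<Sum>A\<in>Pow V. w A * of_bool ({} \<subseteq> A \<and> edge_count A \<le> T) * (\<Prod>j\<in>{m - m..<m}. real (edge_count A - j)))"
    by (intro planted_matching_moment[OF T few pm]) auto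
  also have "\<dots> \<le> (\<Sum>A\<in>Pow V. w A * of_bool (m \<le> edge_count A) * T ^ m)"
  proof (rule sum_mono)
    fix A
    have "of_bool ({} \<subseteq> A \<and> edge_count A \<le> T) * (\<Prod>j\<in>{m - m..<m}. real (edge_count A - j))
       \<le> of_bool (m \<le> edge_count A) * T ^ m"
    proof (cases "m \<le> edge_count A \<and> edge_count A \<le> T")
      case True
      have "(\<Prod>j\<in>{0..<m}. real (edge_count A - j)) \<le> (\<Prod>j\<in>{0..<m}. T)"
        using True by (intro prod_mono) auto
      then show ?thesis using True by simp
    next
      case False
      then consider "\<not> edge_count A \<le> T" | "edge_count A < m" by linarith
      then show ?thesis
      proof cases
        case 2
        \<comment> \<open>The factor with j = \<open>edge_count A\<close> is zero.\<close>
        then have z: "(\<Prod>j\<in>{m - m..<m}. real (edge_count A - j)) = 0" by (intro prod_zero) auto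
        show ?thesis unfolding z using T by simp
      qed (use T in simp)
    qed
    from mult_left_mono[OF this w_nonneg[of A]]
    show "w A * of_bool ({} \<subseteq> A \<and> edge_count A \<le> T) * (\<Prod>j\<in>{m - m..<m}. real (edge_count A - j))
       \<le> w A * of_bool (m \<le> edge_count A) * T ^ m" by (simp add: mult.assoc)
  qed
  also have "\<dots> = pr (\<lambda>A. m \<le> edge_count A) * T ^ m"
    by (simp add: pr_def sum_distrib_right)
  finally have "(card H / 2) ^ m * (p ^ (3 * m) / 2) / T ^ m \<le> pr (\<lambda>A. m \<le> edge_count A)"
    using T by (simp add: field_simps)
  moreover have "(card H / 2) ^ m * (p ^ (3 * m) / 2) / T ^ m = (\<mu> / (2 * T)) ^ m / 2"
    by (simp add: \<mu>_def power_mult power_divide power_mult_distrib)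
  ultimately show ?thesis by simp
qed

text \<open>Hypothesis \<open>c1\<close> makes at most half of all edges interfere with 3 m planted
  vertices (234 = 2 * 13 * 9), while \<open>c2\<close> and \<open>c3\<close> keep the planted mean
  of order m. Each of the m planted edges then costs only a constant factor.\<close>

lemma poisson_lower_tail:
  fixes \<epsilon> :: real
  defines "m \<equiv> nat \<lceil>(1 + \<epsilon>) * \<mu>\<rceil>"
  assumes eps: "0 < \<epsilon>" and \<mu>1: "1 \<le> (1 + \<epsilon>) * \<mu>"
    and c1: "234 * (real D)\<^sup>2 * (real m)\<^sup>2 * card V \<le> card H"
    and c2: "card V * p\<^sup>2 \<le> 1" and c3: "m * p \<le> 1"
  shows "exp (- (2 * (1 + \<epsilon>) * ln (224 * real D * (1 + \<epsilon>))) * \<mu>) \<le> pr (\<lambda>A. (1 + \<epsilon>) * \<mu> \<le> edge_count A)"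
proof -
  have m: "(1 + \<epsilon>) * \<mu> \<le> m" "m \<le> 2 * ((1 + \<epsilon>) * \<mu>)"
    using \<mu>1 unfolding m_def by linarith+
  have \<mu>pos: "\<mu> > 0" using \<mu>1 eps by (smt (verit) mult_nonneg_nonpos)
  have "\<mu> \<le> (1 + \<epsilon>) * \<mu>" using eps \<mu>pos by (simp add: algebra_simps)
  then have \<mu>m: "\<mu> \<le> m" using m by linarith
  have m1: "1 \<le> real m" using m \<mu>1 by linarith
  have D1: "1 \<le> real D" using D_pos by simp
  \<comment> \<open>Twice the bound \<mu> + 3 D m + 9 D m + m \<le> 14 D m on the planted
    mean.\<close>
  define T where "T = 28 * D * real m"
  have T: "T > 0" using m1 D1 by (simp add: T_def)
  have "(\<mu> / (2 * T)) ^ m / 2 \<le> pr (\<lambda>A. m \<le> edge_count A)"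
  proof (rule planted_matching_lower[OF T])
    fix S assume S: "S \<subseteq> V" "card S \<le> 3 * m"
    have "finite S" using S finite_V finite_subset by blast
    from card_interfering_le[OF this]
    have "real (2 * card (interfering S)) \<le> real (2 * (13 * D\<^sup>2 * (card S)\<^sup>2 * card V))"
      by (simp only: of_nat_le_iff)
    also have "\<dots> \<le> 2 * (13 * (real D)\<^sup>2 * (3 * real m)\<^sup>2 * card V)"
    proof -
      have "real (card S) \<le> 3 * real m" using S(2) by linarith
      then have "(real (card S))\<^sup>2 \<le> (3 * real m)\<^sup>2" by (intro power_mono) auto
      then have "2 * (13 * (real D)\<^sup>2 * (real (card S))\<^sup>2 * card V) \<le> 2 * (13 * (real D)\<^sup>2 * (3 * real m)\<^sup>2 * card V)"
        by (intro mult_left_mono mult_right_mono) auto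
      then show ?thesis by simp
    qed
    also have "\<dots> \<le> card H" using c1 by (simp add: power_mult_distrib)
    finally show "2 * card (interfering S) \<le> card H" by (simp only: of_nat_le_iff)
  next
    fix S assume S: "S \<subseteq> V" "card S = 3 * m" "edge_count S = m"
    have "finite S" using S finite_V finite_subset by blast
    from planted_mean_le[OF this p_pos] p_le S
    have "planted_mean p S \<le> \<mu> + p\<^sup>2 * (3 * m * (D * card V)) + p * (D * (3 * real m)\<^sup>2) + m"
      by (simp add: \<mu>_def edge_count_def)
    also have "p\<^sup>2 * (3 * m * (D * card V)) = (3 * D * real m) * (card V * p\<^sup>2)" by simp
    also have "\<dots> \<le> (3 * D * real m) * 1" using c2 by (intro mult_left_mono) auto
    also have "p * (D * (3 * real m)\<^sup>2) = (9 * D * real m) * (m * p)" by (simp add: power2_eq_square)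
    also have "\<dots> \<le> (9 * D * real m) * 1" using c3 by (intro mult_left_mono) auto
    also have "\<mu> + (3 * D * real m) * 1 + (9 * D * real m) * 1 + m \<le> T / 2"
    proof -
      have "real m \<le> D * real m" using D1 m1 by simp
      then show ?thesis using \<mu>m by (simp add: T_def)
    qed
    finally show "planted_mean p S \<le> T / 2" by simp
  qed
  also have "\<dots> \<le> pr (\<lambda>A. (1 + \<epsilon>) * \<mu> \<le> edge_count A)"
    using m by (intro pr_mono) linarith
  finally have lower: "(\<mu> / (2 * T)) ^ m / 2 \<le> pr (\<lambda>A. (1 + \<epsilon>) * \<mu> \<le> edge_count A)" .
  \<comment> \<open>From m \<le> 2 (1 + \<epsilon>) \<mu> one gets \<mu> / (2 T) \<ge> 1 / (112 D (1
    + \<epsilon>)) = 2 / K. Writing the base as 2 / K leaves a factor 2^m that absorbs the final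
    division by 2.\<close>
  define K where "K = 224 * real D * (1 + \<epsilon>)"
  have K1: "K \<ge> 1"
  proof -
    have "1 * 1 \<le> (224 * real D) * (1 + \<epsilon>)" using D1 eps by (intro mult_mono) auto
    then show ?thesis by (simp add: K_def)
  qed
  have twoK: "2 / K \<le> \<mu> / (2 * T)"
  proof -
    have "2 / K = (m / (2 * (1 + \<epsilon>))) / (2 * T)"
    proof -
      have "real D * real m \<noteq> 0" "1 + \<epsilon> \<noteq> 0" using D1 m1 eps by auto
      then show ?thesis by (simp add: K_def T_def divide_simps)
    qed
    also have "\<dots> \<le> \<mu> / (2 * T)"
      using m(2) T eps by (intro divide_right_mono) (auto simp: field_simps)
    finally show ?thesis .
  qed
  have "exp (- (2 * (1 + \<epsilon>) * ln K) * \<mu>) \<le> exp (- (m * ln K))"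
    using mult_right_mono[OF m(2), of "ln K"] K1 by (simp add: algebra_simps)
  also have "\<dots> = (1 / K) ^ m"
    using K1 by (simp add: exp_minus exp_of_nat_mult power_one_over inverse_eq_divide)
  also have "\<dots> = (2 / K) ^ m / 2 ^ m" by (simp add: power_divide)
  also have "\<dots> \<le> (\<mu> / (2 * T)) ^ m / 2"
  proof (rule frac_le)
    show "(2 / K) ^ m \<le> (\<mu> / (2 * T)) ^ m"
      using twoK K1 by (intro power_mono) auto
    show "(2::real) \<le> 2 ^ m" using m1 self_le_power[of "2::real" m] by simp
  qed (use K1 \<mu>pos T in auto)
  finally show ?thesis using lower by (simp add: K_def)
qed

end

text \<open>In this regime \<mu> is at most (ln n)^2, so p^3 is at most of order (ln n)^2 / n^2.
  Each quantity to be bounded is then a power of ln n against a positive power of n.\<close>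

lemma poisson_regime_bounds:
  fixes \<epsilon> c0 D :: real
  assumes "0 < \<epsilon>" "0 < c0" "0 < D"
  shows "\<forall>\<^sub>F n :: nat in sequentially. \<forall>(N::real) (p::real) (\<mu>::real). c0 * (real n)\<^sup>2 \<le> N \<longrightarrow> N \<le> D * (real n)\<^sup>2 \<longrightarrow> 0 < p \<longrightarrow> p < 1 \<longrightarrow>
     \<mu> = N * p ^ 3 \<longrightarrow> 1 \<le> (1 + \<epsilon>) * \<mu> \<longrightarrow> sqrt \<mu> \<le> ln (1 / p) \<longrightarrow>
     234 * D\<^sup>2 * (2 * ((1 + \<epsilon>) * \<mu>))\<^sup>2 * n \<le> N \<and> n * p\<^sup>2 \<le> 1 \<and> 2 * ((1 + \<epsilon>) * \<mu>) * p \<le> 1"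
proof -
  define K1 where "K1 = 936 * D\<^sup>2 * (1 + \<epsilon>)\<^sup>2 / c0"
  define K2 where "K2 = 1 / c0\<^sup>2"
  define K3 where "K3 = 8 * (1 + \<epsilon>) ^ 3 / c0"
  have "\<forall>\<^sub>F n :: nat in sequentially. D * (1 + \<epsilon>) \<le> real n" by real_asymp
  moreover have "\<forall>\<^sub>F n :: nat in sequentially. K1 * ln n ^ 4 \<le> real n" by real_asymp
  moreover have "\<forall>\<^sub>F n :: nat in sequentially. K2 * ln n ^ 4 \<le> real n" by real_asymp
  moreover have "\<forall>\<^sub>F n :: nat in sequentially. K3 * ln n ^ 8 \<le> (real n)\<^sup>2" by real_asymp
  moreover have "\<forall>\<^sub>F n :: nat in sequentially. n > 0" by (rule eventually_gt_at_top)
  ultimately show ?thesis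
  proof eventually_elim
    case (elim n)
    show ?case
    proof (intro allI impI)
      fix N p \<mu> :: real
      assume N: "c0 * (real n)\<^sup>2 \<le> N" "N \<le> D * (real n)\<^sup>2" and p: "0 < p" "p < 1"
        and \<mu>: "\<mu> = N * p ^ 3" and \<mu>1: "1 \<le> (1 + \<epsilon>) * \<mu>" and small: "sqrt \<mu> \<le> ln (1 / p)"
      define L where "L = ln n"
      have n: "real n > 0" using elim by simp
      have Npos: "N > 0" 
      proof -
        have "0 < c0 * (real n)\<^sup>2" using n assms by simp
        with N(1) show ?thesis by linarith
      qed
      then have \<mu>pos: "\<mu> > 0" using \<mu> p by simp
      \<comment> \<open>Since D (1 + \<epsilon>) \<le> n, the lower bound on \<mu> gives 1 \<le> (n
        p)^3. Hence ln (1 / p) \<le> ln n.\<close>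
      have "1 \<le> (1 + \<epsilon>) * (D * (real n)\<^sup>2 * p ^ 3)"
      proof -
        have "\<mu> \<le> D * (real n)\<^sup>2 * p ^ 3" unfolding \<mu> using N p by (intro mult_right_mono) auto
        then have "(1 + \<epsilon>) * \<mu> \<le> (1 + \<epsilon>) * (D * (real n)\<^sup>2 * p ^ 3)" using assms by (intro mult_left_mono) auto
        with \<mu>1 show ?thesis by linarith
      qed
      also have "\<dots> = (D * (1 + \<epsilon>)) * ((real n)\<^sup>2 * p ^ 3)" by (simp add: mult_ac)
      also have "\<dots> \<le> n * ((real n)\<^sup>2 * p ^ 3)" using elim p by (intro mult_right_mono) auto
      also have "\<dots> = (n * p) ^ 3" by (simp add: power_mult_distrib eval_nat_numeral)
      finally have "1 \<le> real n * p"
        using power_mono_iff[of 1 "n * p" 3] n p by simp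
      then have "1 / p \<le> n" using p by (simp add: field_simps)
      then have "ln (1 / p) \<le> L" using p n by (simp add: L_def)
      then have sL: "sqrt \<mu> \<le> L" using small by linarith
      have "(sqrt \<mu>)\<^sup>2 \<le> L\<^sup>2" using sL \<mu>pos by (intro power_mono) auto
      then have \<mu>L: "\<mu> \<le> L\<^sup>2" using \<mu>pos by simp
      have "c0 * (real n)\<^sup>2 * p ^ 3 \<le> \<mu>" unfolding \<mu> using N p by (intro mult_right_mono) auto
      then have "c0 * (real n)\<^sup>2 * p ^ 3 \<le> L\<^sup>2" using \<mu>L by linarith
      then have pL: "p ^ 3 \<le> L\<^sup>2 / (c0 * (real n)\<^sup>2)" using assms n by (simp add: field_simps)
      have "234 * D\<^sup>2 * (2 * ((1 + \<epsilon>) * \<mu>))\<^sup>2 * n \<le> 234 * D\<^sup>2 * (2 * ((1 + \<epsilon>) * L\<^sup>2))\<^sup>2 * n"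
        using \<mu>L \<mu>pos assms by (intro mult_left_mono mult_right_mono power_mono) auto
      also have "\<dots> = c0 * (K1 * L ^ 4) * n"
        using assms by (simp add: K1_def power_mult_distrib flip: power_mult)
      also have "\<dots> \<le> c0 * real n * n"
        using elim assms by (intro mult_left_mono mult_right_mono) (auto simp: L_def)
      also have "\<dots> \<le> N" using N(1) by (simp add: power2_eq_square mult.assoc)
      finally have A: "234 * D\<^sup>2 * (2 * ((1 + \<epsilon>) * \<mu>))\<^sup>2 * n \<le> N" .
      \<comment> \<open>Cubes are compared because the information on p is a bound for p^3.\<close>
      have "(n * p\<^sup>2) ^ 3 = real n ^ 3 * (p ^ 3)\<^sup>2"
        by (simp add: power_mult_distrib flip: power_mult)
      also have "\<dots> \<le> real n ^ 3 * (L\<^sup>2 / (c0 * (real n)\<^sup>2))\<^sup>2"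
        using pL p by (intro mult_left_mono power_mono) auto
      also have "\<dots> = K2 * L ^ 4 / n"
        using n by (simp add: K2_def power_mult_distrib power_divide field_simps eval_nat_numeral)
      also have "\<dots> \<le> 1" using elim n by (simp add: L_def)
      finally have B: "n * p\<^sup>2 \<le> 1"
        using power_mono_iff[of "n * p\<^sup>2" 1 3] n p by simp
      have "(2 * ((1 + \<epsilon>) * \<mu>) * p) ^ 3 = (2 * ((1 + \<epsilon>) * \<mu>)) ^ 3 * p ^ 3"
        by (rule power_mult_distrib)
      also have "\<dots> \<le> (2 * ((1 + \<epsilon>) * L\<^sup>2)) ^ 3 * (L\<^sup>2 / (c0 * (real n)\<^sup>2))"
        using pL \<mu>L \<mu>pos p assms by (intro mult_mono power_mono mult_left_mono) auto
      also have "\<dots> = K3 * L ^ 8 / (real n)\<^sup>2"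
        using assms n by (simp add: K3_def power_mult_distrib field_simps eval_nat_numeral)
      also have "\<dots> \<le> 1" using elim n by (simp add: L_def)
      finally have "2 * ((1 + \<epsilon>) * \<mu>) * p \<le> 1"
        using power_mono_iff[of "2 * ((1 + \<epsilon>) * \<mu>) * p" 1 3] \<mu>pos p assms by simp
      with A B show "234 * D\<^sup>2 * (2 * ((1 + \<epsilon>) * \<mu>))\<^sup>2 * n \<le> N \<and> n * p\<^sup>2 \<le> 1 \<and> 2 * ((1 + \<epsilon>) * \<mu>) * p \<le> 1"
        by blast
    qed
  qed
qed

section \<open>Sums in random sets of integers\<close>

lemma set_pmf_binomial_subset: "set_pmf (binomial_subset n p) \<subseteq> Pow {1..n}"
  by (auto simp: binomial_subset_def)

lemma expectation_binomial_subset: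
  "measure_pmf.expectation (binomial_subset n p) f = (\<Sum>A\<in>Pow {1..n}. pmf (binomial_subset n p) A * f A)"
proof -
  have "measure_pmf.expectation (binomial_subset n p) f = (\<Sum>A\<in>Pow {1..n}. f A * pmf (binomial_subset n p) A)"
    by (rule integral_measure_pmf_real) (use set_pmf_binomial_subset in auto)
  then show ?thesis by (simp only: mult.commute)
qed

lemma prob_binomial_subset:
  "measure_pmf.prob (binomial_subset n p) {A. Q A}
     = (\<Sum>A\<in>Pow {1..n}. pmf (binomial_subset n p) A * of_bool (Q A))"
proof -
  have "measure_pmf.prob (binomial_subset n p) {A. Q A}
      = measure_pmf.expectation (binomial_subset n p) (indicator {A. Q A})" by simp
  also have "\<dots> = (\<Sum>A\<in>Pow {1..n}. pmf (binomial_subset n p) A * of_bool (Q A))"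
    unfolding expectation_binomial_subset by (simp add: indicator_def of_bool_def)
  finally show ?thesis .
qed

lemma prob_binomial_subset_contains:
  assumes "0 \<le> p" "p \<le> 1" "S \<subseteq> {1..n}"
  shows "measure_pmf.prob (binomial_subset n p) {A. S \<subseteq> A} = p ^ card S"
proof -
  define B where "B i = (if i \<in> S then {True} else UNIV)" for i :: nat
  have "(\<lambda>f. {i \<in> {1..n}. f i}) -` {A. S \<subseteq> A} = Pi {1..n} B"
    using assms(3) by (auto simp: B_def Pi_def split: if_splits)
  then have "measure_pmf.prob (binomial_subset n p) {A. S \<subseteq> A}
      = measure_pmf.prob (Pi_pmf {1..n} False (\<lambda>_. bernoulli_pmf p)) (Pi {1..n} B)"
    by (simp add: binomial_subset_def)
  also have "\<dots> = (\<Prod>i\<in>{1..n}. measure_pmf.prob (bernoulli_pmf p) (B i))"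
    by (rule measure_Pi_pmf_Pi) simp
  also have "\<dots> = (\<Prod>i\<in>{1..n}. if i \<in> S then p else 1)"
    using assms by (intro prod.cong refl) (auto simp: B_def measure_pmf_single)
  also have "\<dots> = p ^ card S"
    using assms(3) by (simp add: prod.If_cases Int_absorb1)
  finally show ?thesis .
qed

text \<open>A set {x, y, z} of cardinality 3 has x and y distinct, which supplies the condition in
  the Schur definition. Schur triples thus become the case l = 1.\<close>

lemma schur_triples_eq_l_sums: "schur_triples A = l_sums 1 A"
proof -
  have neq: "x \<noteq> y" if "card {x, y, z} = 3" for x y z :: nat
  proof
    assume "x = y"
    then have "card {x, y, z} \<le> 2" using card_insert_le_m1[of 2 "{z}" y] by simp
    with that show False by simp
  qed
  show ?thesis
  proof (intro set_eqI iffI)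
    fix T assume "T \<in> schur_triples A"
    then show "T \<in> l_sums 1 A" unfolding schur_triples_def l_sums_def mult_1 by blast
  next
    fix T assume "T \<in> l_sums 1 A"
    then obtain x y z where T: "T \<subseteq> A" "card T = 3" "T = {x, y, z}" "x + y = z"
      unfolding l_sums_def mult_1 by blast
    have "card {x, y, z} = 3" using T(2,3) by simp
    from neq[OF this] have "x \<noteq> y" .
    with T(3,4) have "\<exists>x y z. T = {x, y, z} \<and> x \<noteq> y \<and> x + y = z"
      by iprover
    with T(1,2) show "T \<in> schur_triples A"
      unfolding schur_triples_def by (intro CollectI conjI)
  qed
qed

text \<open>Once the roles of a and b in the equation are fixed, the third element is determined. Up
  to exchanging x and y there are three assignments of roles.\<close>

lemma codegree_l_sums:
  assumes "l \<ge> 1" "a \<noteq> b"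
  shows "card {T \<in> l_sums l A. a \<in> T \<and> b \<in> T} \<le> 3"
proof -
  have "{T \<in> l_sums l A. a \<in> T \<and> b \<in> T} \<subseteq> {{a, b, (a + b) div l}, {a, b, l * a - b}, {a, b, l * b - a}}"
  proof
    fix T assume "T \<in> {T \<in> l_sums l A. a \<in> T \<and> b \<in> T}"
    then obtain x y z where T: "T = {x, y, z}" "x + y = l * z" "a \<in> T" "b \<in> T"
      by (auto simp: l_sums_def)
    have xyz: "z = (x + y) div l" "y = l * z - x" "x = l * z - y"
      using T(2) assms(1) by auto
    from T(1,3,4) assms(2) consider "a = x" "b = y" | "a = y" "b = x" | "a = x" "b = z" | "a = z" "b = x"
      | "a = y" "b = z" | "a = z" "b = y" by auto
    then show "T \<in> {{a, b, (a + b) div l}, {a, b, l * a - b}, {a, b, l * b - a}}"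
    proof cases
      case 1
      then have "T = {a, b, (a + b) div l}" using T(1) xyz(1) by simp
      then show ?thesis by simp
    next
      case 2
      then have "T = {a, b, (a + b) div l}" using T(1) xyz(1) by (simp add: insert_commute add.commute)
      then show ?thesis by simp
    next
      case 3
      then have "T = {a, b, l * b - a}" using T(1) xyz(2) by (simp add: insert_commute)
      then show ?thesis by simp
    next
      case 4
      then have "T = {a, b, l * a - b}" using T(1) xyz(2) by (simp add: insert_commute)
      then show ?thesis by simp
    next
      case 5
      then have "T = {a, b, l * b - a}" using T(1) xyz(3) by (simp add: insert_commute)
      then show ?thesis by simp
    next
      case 6
      then have "T = {a, b, l * a - b}" using T(1) xyz(3) by (simp add: insert_commute)
      then show ?thesis by simp
    qed
  qed
  from card_mono[OF _ this] show ?thesis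
    by (rule order_trans) (simp_all add: card_insert_if)
qed

lemma finite_l_sums: "finite A \<Longrightarrow> finite (l_sums l A)"
  unfolding l_sums_def by (rule finite_subset[of _ "Pow A"]) auto

text \<open>Choosing z in (2 q, 3 q] and x in [1, q] determines y = l z - x, and every such pair
  gives a triple inside {1..m}. A triple T accounts for at most the 9 pairs in T \<times> T.\<close>

lemma card_l_sums_ge:
  assumes l: "l \<ge> 1" and m: "m \<ge> 6 * l"
  shows "1 / (324 * (real l)\<^sup>2) * (real m)\<^sup>2 \<le> card (l_sums l {1..m})"
proof -
  define q where "q = m div (3 * l)"
  define P where "P = {2 * q + 1..3 * q} \<times> {1..q}"
  have q: "3 * l * q \<le> m" by (simp add: q_def)
  have "P \<subseteq> (\<Union>T\<in>l_sums l {1..m}. T \<times> T)"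
  proof
    fix u assume "u \<in> P"
    then obtain z x where u: "u = (z, x)" and z: "2 * q < z" "z \<le> 3 * q" and x: "1 \<le> x" "x \<le> q"
      by (auto simp: P_def)
    define y where "y = l * z - x"
    have "l * z \<le> 3 * l * q" using mult_le_mono2[OF z(2), of l] by (simp add: mult_ac)
    then have "l * z \<le> m" using q by (rule order_trans)
    moreover have "z \<le> l * z" using l by simp
    ultimately have lz: "z \<le> l * z" "l * z \<le> m" by simp_all
    have xy: "x + y = l * z" using lz z x unfolding y_def by linarith
    have "y \<noteq> z"
    proof
      assume "y = z"
      show False
      proof (cases "l = 1")
        case True then show False using xy \<open>y = z\<close> x by simp
      next
        case False
        then have "2 * z \<le> l * z" using l by (intro mult_le_mono1) simp
        then show False using xy \<open>y = z\<close> x z by linarith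
      qed
    qed
    moreover have "x \<noteq> y" "x \<noteq> z" "y \<ge> 1" "y \<le> m" "x \<le> m" "1 \<le> z" "z \<le> m" using xy lz z x by linarith+
    ultimately have "{x, y, z} \<in> l_sums l {1..m}" using xy x unfolding l_sums_def by auto
    then show "u \<in> (\<Union>T\<in>l_sums l {1..m}. T \<times> T)" using u by blast
  qed
  then have "card P \<le> card (\<Union>T\<in>l_sums l {1..m}. T \<times> T)"
    by (rule card_mono[rotated]) (auto simp: finite_l_sums l_sums_def intro: card_ge_0_finite)
  also have "\<dots> \<le> (\<Sum>T\<in>l_sums l {1..m}. card (T \<times> T))"
    by (rule card_UN_le) (simp add: finite_l_sums)
  also have "\<dots> = (\<Sum>T\<in>l_sums l {1..m}. 9)"
    by (intro sum.cong refl) (auto simp: l_sums_def card_cartesian_product)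
  also have "\<dots> = 9 * card (l_sums l {1..m})" by simp
  finally have "q * q \<le> 9 * card (l_sums l {1..m})" by (simp add: P_def card_cartesian_product)
  then have 1: "real q * real q \<le> 9 * card (l_sums l {1..m})"
    by (simp flip: of_nat_mult)
  \<comment> \<open>The remainder is below 3 l, which m \<ge> 6 l makes smaller than 3 l q; hence m
    \<le> 6 l q, and 324 = 9 * 36.\<close>
  have "m = 3 * l * q + m mod (3 * l)" by (simp add: q_def)
  moreover have "m mod (3 * l) < 3 * l" using l by simp
  ultimately have "m \<le> 6 * l * q" using m by linarith
  then have "real m \<le> 6 * real l * real q" by (metis of_nat_le_iff of_nat_mult of_nat_numeral)
  then have "(real m)\<^sup>2 \<le> (6 * real l * real q)\<^sup>2" by (intro power_mono) auto
  also have "\<dots> = 36 * (real l)\<^sup>2 * (real q * real q)" by (simp add: power2_eq_square)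
  also have "\<dots> \<le> 36 * (real l)\<^sup>2 * (9 * card (l_sums l {1..m}))" using 1 by (intro mult_left_mono) auto
  finally show ?thesis using l by (simp add: field_simps)
qed

lemma l_sums_subset: "A \<subseteq> B \<Longrightarrow> {e \<in> l_sums l B. e \<subseteq> A} = l_sums l A"
  by (auto simp: l_sums_def)

lemma random_vertex_set_l_sums:
  assumes "l \<ge> 1" "0 < p" "p \<le> 1"
  shows "random_vertex_set {1..n} (l_sums l {1..n}) 3 p (pmf (binomial_subset n p))"
proof
  show "(\<Sum>A\<in>Pow {1..n}. pmf (binomial_subset n p) A * of_bool (S \<subseteq> A)) = p ^ card S"
    if "S \<subseteq> {1..n}" for S
    using prob_binomial_subset_contains[of p S n] prob_binomial_subset[of n p "\<lambda>A. S \<subseteq> A"] assms that by simp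
qed (use assms codegree_l_sums in \<open>auto simp: l_sums_def\<close>)

section \<open>First-moment and cluster bounds\<close>

context random_vertex_set
begin

lemma sum_w_edge_count_eq_\<mu>: "(\<Sum>A\<in>Pow V. w A * edge_count A) = \<mu>"
  using sum_w_edge_count[of "{}"] by (simp add: planted_mean_def \<mu>_def edge_card)

lemma markov:
  fixes a :: real
  assumes "a > 0"
  shows "pr (\<lambda>A. a \<le> edge_count A) \<le> \<mu> / a"
proof -
  have "pr (\<lambda>A. a \<le> edge_count A) \<le> (\<Sum>A\<in>Pow V. w A * (edge_count A / a))"
    unfolding pr_def using assms by (intro sum_mono mult_left_mono w_nonneg) (auto simp: field_simps)
  also have "\<dots> = \<mu> / a"
    by (simp add: sum_w_edge_count_eq_\<mu>[symmetric] sum_divide_distrib)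
  finally show ?thesis .
qed

lemma cluster_lower_tail:
  fixes a :: real
  assumes "S \<subseteq> V" "a \<le> edge_count S"
  shows "p ^ card S \<le> pr (\<lambda>A. a \<le> edge_count A)"
proof -
  have "edge_count S \<le> edge_count A" if "S \<subseteq> A" for A
    unfolding edge_count_def using that finite_H by (intro card_mono) auto
  then have "pr (\<lambda>A. S \<subseteq> A) \<le> pr (\<lambda>A. a \<le> edge_count A)"
    using assms(2) by (intro pr_mono) (meson of_nat_mono order_trans)
  then show ?thesis using pr_contains[OF assms(1)] by simp
qed

end

text \<open>The exponential beats the quadratic factor for all t beyond some t0. Taking C \<le> c' /
  t0 moves the whole range t \<ge> c' / C beyond t0.\<close>

lemma upper_tail_constant:
  fixes \<epsilon> c0 D :: real
  assumes "0 < \<epsilon>" "0 < c0" "0 < D"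
  obtains C where "0 < C" "C \<le> 1" "8 * D * C \<le> \<epsilon> * sqrt c0" "2304 * D * C \<le> \<epsilon>"
    "\<And>t. t \<ge> sqrt (\<epsilon> / (8 * D)) / C \<Longrightarrow>
      exp (- t / 16) * ((sqrt (\<epsilon> / (8 * D)) * sqrt c0) powr (-7/12) * exp 3 * (1 + 288 * D * D * t\<^sup>2 / \<epsilon>)) \<le> 1 / 2"
proof -
  define c' where "c' = sqrt (\<epsilon> / (8 * D))"
  have c': "c' > 0" using assms by (simp add: c'_def)
  define K1 where "K1 = (c' * sqrt c0) powr (-7/12) * exp 3"
  define K2 where "K2 = 288 * D * D / \<epsilon>"
  have "\<forall>\<^sub>F t in at_top. exp (- t / 16) * (K1 * (1 + K2 * t\<^sup>2)) \<le> 1 / 2"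
    by real_asymp
  then obtain t1 where t1: "\<And>t. t \<ge> t1 \<Longrightarrow> exp (- t / 16) * (K1 * (1 + K2 * t\<^sup>2)) \<le> 1 / 2"
    by (auto simp: eventually_at_top_linorder)
  define t0 where "t0 = max 1 t1"
  have t0: "t0 > 0" "t1 \<le> t0" by (auto simp: t0_def)
  define C where "C = Min {1, \<epsilon> * sqrt c0 / (8 * D), \<epsilon> / (2304 * D), c' / t0}"
  have C: "C > 0" "C \<le> 1" "C \<le> \<epsilon> * sqrt c0 / (8 * D)" "C \<le> \<epsilon> / (2304 * D)" "C \<le> c' / t0"
    using assms c' t0 by (auto simp: C_def)
  show thesis
  proof (rule that[OF C(1,2)])
    show "8 * D * C \<le> \<epsilon> * sqrt c0" "2304 * D * C \<le> \<epsilon>"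
      using C(3,4) assms by (simp_all add: field_simps)
    fix t assume "t \<ge> sqrt (\<epsilon> / (8 * D)) / C"
    then have "c' / C \<le> t" by (simp add: c'_def)
    moreover have "t0 \<le> c' / C" using C(1,5) t0 by (simp add: field_simps)
    ultimately have "t1 \<le> t" using t0 by linarith
    from t1[OF this]
    show "exp (- t / 16) * ((sqrt (\<epsilon> / (8 * D)) * sqrt c0) powr (-7/12) * exp 3 * (1 + 288 * D * D * t\<^sup>2 / \<epsilon>)) \<le> 1 / 2"
      unfolding K1_def K2_def c'_def by simp
  qed
qed

text \<open>For a \<Phi> \<ge> 2 ln 2 the factor 2 is at most exp (a \<Phi> / 2). For smaller \<Phi>
  the first bound may be trivial, but then the rate is small enough for 1 / (1 + \<epsilon>), the
  Markov bound, to suffice.\<close>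

lemma absorb_factor_two:
  fixes a \<epsilon> x \<Phi> :: real
  assumes a: "0 < a" and eps: "0 < \<epsilon>" and \<Phi>: "0 \<le> \<Phi>" and x: "x \<le> 2 * exp (- a * \<Phi>)" "x \<le> 1 / (1 + \<epsilon>)"
  shows "x \<le> exp (- (min (a / 2) (a * ln (1 + \<epsilon>) / (2 * ln 2))) * \<Phi>)"
proof (cases "2 * ln 2 \<le> a * \<Phi>")
  case True
  have "2 * exp (- a * \<Phi>) = exp (ln 2 - a * \<Phi>)" by (simp add: exp_diff exp_minus divide_inverse)
  also have "\<dots> \<le> exp (- (a / 2 * \<Phi>))" using True by simp
  also have "\<dots> \<le> exp (- (min (a / 2) (a * ln (1 + \<epsilon>) / (2 * ln 2))) * \<Phi>)"
    using mult_right_mono[OF min.cobounded1 \<Phi>, of "a / 2"] by simp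
  finally show ?thesis using x by linarith
next
  case False
  have "min (a / 2) (a * ln (1 + \<epsilon>) / (2 * ln 2)) * \<Phi> \<le> a * ln (1 + \<epsilon>) / (2 * ln 2) * \<Phi>"
    using \<Phi> by (intro mult_right_mono) auto
  also have "\<dots> = ln (1 + \<epsilon>) * (a * \<Phi> / (2 * ln 2))" by simp
  also have "\<dots> \<le> ln (1 + \<epsilon>) * 1"
    using False eps by (intro mult_left_mono) (auto simp: field_simps)
  finally have "exp (- ln (1 + \<epsilon>)) \<le> exp (- (min (a / 2) (a * ln (1 + \<epsilon>) / (2 * ln 2))) * \<Phi>)" by simp
  then show ?thesis using x eps by (simp add: exp_minus inverse_eq_divide)
qed

section \<open>The upper tail with a single exponential\<close>

context random_vertex_set
begin

lemma upper_tail_bound: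
  fixes \<epsilon> c0 C :: real
  defines "a \<equiv> min (sqrt (\<epsilon> / (8 * real D)) / 16) (ln ((1 + \<epsilon>) / (1 + \<epsilon> / 2)) * C / 3)"
  assumes "p < 1" "0 < \<epsilon>" "0 < c0" "0 < C" "C \<le> 1"
    "c0 * (real (card V))\<^sup>2 \<le> card H" "H \<noteq> {}"
    "8 * real D * C \<le> \<epsilon> * sqrt c0" "2304 * real D * C \<le> \<epsilon>"
    "\<And>t::real. t \<ge> sqrt (\<epsilon> / (8 * real D)) / C \<Longrightarrow>
      exp (- t / 16) * ((sqrt (\<epsilon> / (8 * real D)) * sqrt c0) powr (-7/12) * exp 3 * (1 + 288 * real D * real D * t\<^sup>2 / \<epsilon>)) \<le> 1 / 2"
  shows "pr (\<lambda>A. (1 + \<epsilon>) * \<mu> \<le> edge_count A)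
    \<le> exp (- (min (a / 2) (a * ln (1 + \<epsilon>) / (2 * ln 2))) * min \<mu> (sqrt \<mu> * ln (1 / p)))"
proof -
  interpret upper_tail_setup V H D p w \<epsilon> c0 C
    by unfold_locales (use assms in auto)
  define x where "x = pr (\<lambda>A. (1 + \<epsilon>) * \<mu> \<le> edge_count A)"
  have "1 < (1 + \<epsilon>) / (1 + \<epsilon> / 2)" using eps by (simp add: field_simps)
  then have a: "0 < a" using c'_pos C by (simp add: a_def c'_def)
  have "exp (- (c' / 16) * \<Phi>) \<le> exp (- a * \<Phi>)"
    "exp (- (ln ((1 + \<epsilon>) / (1 + \<epsilon> / 2)) * C / 3) * \<Phi>) \<le> exp (- a * \<Phi>)"
    using \<Phi>_pos by (simp_all add: a_def c'_def mult_right_mono)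
  then have "x \<le> 2 * exp (- a * \<Phi>)" using upper_tail unfolding x_def by linarith
  moreover have "x \<le> 1 / (1 + \<epsilon>)"
    using markov[of "(1 + \<epsilon>) * \<mu>"] eps \<mu>_pos by (simp add: x_def)
  ultimately have "x \<le> exp (- (min (a / 2) (a * ln (1 + \<epsilon>) / (2 * ln 2))) * \<Phi>)"
    by (intro absorb_factor_two a eps) (use \<Phi>_pos in auto)
  then show ?thesis by (simp add: x_def \<Phi>_def t_def)
qed

end

section \<open>Both bounds for l-sums, and the theorem\<close>

text \<open>The case \<open>p = 1\<close> is excluded by \<open>(1 + \<epsilon>) * \<mu> \<le> l_sum_count l {1..n}\<close>.\<close>

lemma l_sum_tail_bounds:
  fixes \<epsilon> :: real and l :: nat
  assumes l: "l \<ge> 1" and eps: "\<epsilon> > 0"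
  shows "\<exists>(c::real) (C::real) (n0::nat). c > 0 \<and> C > 0 \<and>
          (\<forall>(n::nat) (p::real). n \<ge> n0 \<and> 0 < p \<and> p \<le> 1 \<longrightarrow>
            (let \<mu> = measure_pmf.expectation (binomial_subset n p) (l_sum_count l);
                 \<Phi> = min \<mu> (sqrt \<mu> * ln (1 / p));
                 P = measure_pmf.prob (binomial_subset n p) {A. l_sum_count l A \<ge> (1 + \<epsilon>) * \<mu>}
             in 1 \<le> (1 + \<epsilon>) * \<mu> \<and> (1 + \<epsilon>) * \<mu> \<le> l_sum_count l {1..n} \<longrightarrow>
                exp (- C * \<Phi>) \<le> P \<and> P \<le> exp (- c * \<Phi>)))"
proof -
  define c0 where "c0 = 1 / (324 * (real l)\<^sup>2)"
  have c0: "c0 > 0" using l by (simp add: c0_def)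
  obtain C where C: "0 < C" "C \<le> 1" "8 * real 3 * C \<le> \<epsilon> * sqrt c0" "2304 * real 3 * C \<le> \<epsilon>"
    and C3: "\<And>t. t \<ge> sqrt (\<epsilon> / (8 * real 3)) / C \<Longrightarrow> exp (- t / 16) *
      ((sqrt (\<epsilon> / (8 * real 3)) * sqrt c0) powr (-7/12) * exp 3 * (1 + 288 * real 3 * real 3 * t\<^sup>2 / \<epsilon>)) \<le> 1 / 2"
    by (rule upper_tail_constant[OF eps c0, of "real 3"], simp) (rule that; assumption)
  define a where "a = min (sqrt (\<epsilon> / (8 * real 3)) / 16) (ln ((1 + \<epsilon>) / (1 + \<epsilon> / 2)) * C / 3)"
  define c where "c = min (a / 2) (a * ln (1 + \<epsilon>) / (2 * ln 2))"
  have "1 < (1 + \<epsilon>) / (1 + \<epsilon> / 2)" using eps by (simp add: field_simps)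
  then have "a > 0" using C eps by (simp add: a_def)
  then have c: "c > 0" using eps by (simp add: c_def)
  \<comment> \<open>Chosen so that the planted interval {1..M} below has M \<le> C1 sqrt \<mu>; C2
    is the rate of \<open>poisson_lower_tail\<close>.\<close>
  define C1 where "C1 = sqrt ((1 + \<epsilon>) / c0) + (1 + 6 * real l) * sqrt (1 + \<epsilon>)"
  define C2 where "C2 = 2 * (1 + \<epsilon>) * ln (224 * real 3 * (1 + \<epsilon>))"
  have C1: "C1 > 0" using eps c0 by (simp add: C1_def add_nonneg_pos)
  obtain n1 where n1: "\<forall>n\<ge>n1. \<forall>(N::real) (p::real) (\<mu>::real). c0 * (real n)\<^sup>2 \<le> N \<longrightarrow> N \<le> 3 * (real n)\<^sup>2 \<longrightarrow>
     0 < p \<longrightarrow> p < 1 \<longrightarrow> \<mu> = N * p ^ 3 \<longrightarrow> 1 \<le> (1 + \<epsilon>) * \<mu> \<longrightarrow> sqrt \<mu> \<le> ln (1 / p) \<longrightarrow>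
     234 * 3\<^sup>2 * (2 * ((1 + \<epsilon>) * \<mu>))\<^sup>2 * n \<le> N \<and> n * p\<^sup>2 \<le> 1 \<and> 2 * ((1 + \<epsilon>) * \<mu>) * p \<le> 1"
    using poisson_regime_bounds[OF eps c0, of 3] unfolding eventually_sequentially by auto
  define n0 where "n0 = max n1 (6 * l)"
  have main: "let \<mu> = measure_pmf.expectation (binomial_subset n p) (l_sum_count l);
                 \<Phi> = min \<mu> (sqrt \<mu> * ln (1 / p));
                 P = measure_pmf.prob (binomial_subset n p) {A. l_sum_count l A \<ge> (1 + \<epsilon>) * \<mu>}
             in 1 \<le> (1 + \<epsilon>) * \<mu> \<and> (1 + \<epsilon>) * \<mu> \<le> l_sum_count l {1..n} \<longrightarrow>
                exp (- max C1 C2 * \<Phi>) \<le> P \<and> P \<le> exp (- c * \<Phi>)"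
    if np: "n \<ge> n0 \<and> 0 < p \<and> p \<le> 1" for n p
  proof -
    from np have n: "n \<ge> n1" "n \<ge> 6 * l" and p: "0 < p" "p \<le> 1" by (auto simp: n0_def)
    interpret random_vertex_set "{1..n}" "l_sums l {1..n}" 3 p "pmf (binomial_subset n p)"
      by (rule random_vertex_set_l_sums[OF l p])
    have count: "l_sum_count l A = edge_count A" if "A \<subseteq> {1..n}" for A
      unfolding l_sum_count_def edge_count_def l_sums_subset[OF that] ..
    have mean: "measure_pmf.expectation (binomial_subset n p) (l_sum_count l) = \<mu>"
      unfolding expectation_binomial_subset sum_w_edge_count_eq_\<mu>[symmetric]
      by (intro sum.cong refl) (simp add: count)
    have prob: "measure_pmf.prob (binomial_subset n p) {A. l_sum_count l A \<ge> b} = pr (\<lambda>A. b \<le> edge_count A)" for b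
      unfolding prob_binomial_subset pr_def by (intro sum.cong refl) (simp add: count)
    define N where "N = real (card (l_sums l {1..n}))"
    define P where "P = pr (\<lambda>A. (1 + \<epsilon>) * \<mu> \<le> edge_count A)"
    define \<Phi> where "\<Phi> = min \<mu> (sqrt \<mu> * ln (1 / p))"
    have N: "c0 * (real n)\<^sup>2 \<le> N" using card_l_sums_ge[OF l n(2)] by (simp add: c0_def N_def)
    have N3: "N \<le> 3 * (real n)\<^sup>2"
    proof -
      have "real (card (l_sums l {1..n})) \<le> real (3 * n\<^sup>2)"
        using card_H_le unfolding of_nat_le_iff by simp
      then show ?thesis by (simp add: N_def)
    qed
    have \<mu>N: "\<mu> = N * p ^ 3" by (simp only: \<mu>_def N_def)
    have "exp (- max C1 C2 * \<Phi>) \<le> P \<and> P \<le> exp (- c * \<Phi>)"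
      if \<mu>1: "1 \<le> (1 + \<epsilon>) * \<mu>" and \<mu>N1: "(1 + \<epsilon>) * \<mu> \<le> l_sum_count l {1..n}"
    proof
      have \<mu>pos: "\<mu> > 0" using \<mu>1 eps by (smt (verit) mult_nonneg_nonpos)
      then have Npos: "N > 0" using \<mu>N p by (simp add: zero_less_mult_iff)
      have p1: "p < 1"
      proof (rule ccontr)
        assume "\<not> p < 1"
        then have "\<mu> = N" using \<mu>N p by simp
        then have "(1 + \<epsilon>) * N \<le> N" using \<mu>N1 by (simp add: l_sum_count_def N_def)
        then show False using mult_pos_pos[OF eps Npos] by (simp add: algebra_simps)
      qed
      have t: "ln (1 / p) > 0" using p p1 by (simp add: ln_div)
      show "P \<le> exp (- c * \<Phi>)"
        unfolding P_def \<Phi>_def c_def a_def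
        by (rule upper_tail_bound[OF p1 eps c0 C(1,2) _ _ C(3,4) C3])
          (use N Npos in \<open>auto simp: N_def\<close>)
      show "exp (- max C1 C2 * \<Phi>) \<le> P"
      \<comment> \<open>The comparison decides which term of \<Phi> is the minimum: planting a
        matching gives the rate \<mu>, planting an interval the rate sqrt \<mu> ln (1 / p).\<close>
      proof (cases "sqrt \<mu> \<le> ln (1 / p)")
        case True
        have "sqrt \<mu> * sqrt \<mu> \<le> sqrt \<mu> * ln (1 / p)" using True \<mu>pos by (intro mult_left_mono) auto
        then have \<Phi>: "\<Phi> = \<mu>" using \<mu>pos by (simp add: \<Phi>_def)
        note b = n1[rule_format, OF n(1) N N3 p(1) p1 \<mu>N \<mu>1 True]
        define m where "m = nat \<lceil>(1 + \<epsilon>) * \<mu>\<rceil>"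
        have m: "real m \<le> 2 * ((1 + \<epsilon>) * \<mu>)" using \<mu>1 unfolding m_def by linarith
        have "exp (- C2 * \<mu>) \<le> P"
          unfolding P_def C2_def
        proof (rule poisson_lower_tail[OF eps \<mu>1])
          have "(real m)\<^sup>2 \<le> (2 * ((1 + \<epsilon>) * \<mu>))\<^sup>2"
            using m by (intro power_mono) auto
          then have "234 * 3\<^sup>2 * (real m)\<^sup>2 * n \<le> 234 * 3\<^sup>2 * (2 * ((1 + \<epsilon>) * \<mu>))\<^sup>2 * n"
            by (intro mult_left_mono mult_right_mono) auto
          also have "\<dots> \<le> N" using b by blast
          finally show "234 * (real 3)\<^sup>2 * (real (nat \<lceil>(1 + \<epsilon>) * \<mu>\<rceil>))\<^sup>2 * card {1..n} \<le> card (l_sums l {1..n})"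
            by (simp add: N_def m_def)
          have "m * p \<le> 2 * ((1 + \<epsilon>) * \<mu>) * p" using m p by (intro mult_right_mono) auto
          also have "\<dots> \<le> 1" using b by blast
          finally show "nat \<lceil>(1 + \<epsilon>) * \<mu>\<rceil> * p \<le> 1" by (simp only: m_def)
          show "card {1..n} * p\<^sup>2 \<le> 1" using b by simp
        qed
        moreover have "exp (- max C1 C2 * \<mu>) \<le> exp (- C2 * \<mu>)" using \<mu>pos by (simp add: mult_right_mono)
        ultimately show ?thesis unfolding \<Phi> by linarith
      next
        case False
        have "sqrt \<mu> * ln (1 / p) \<le> sqrt \<mu> * sqrt \<mu>" using False \<mu>pos by (intro mult_left_mono) auto
        then have \<Phi>: "\<Phi> = sqrt \<mu> * ln (1 / p)" using \<mu>pos by (simp add: \<Phi>_def)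
        \<comment> \<open>By this choice c0 s^2 = (1 + \<epsilon>) \<mu>, so an interval of length
          at least s contains enough triples. The summand 6 l in M meets the hypothesis of
          \<open>card_l_sums_ge\<close>; if M is capped at n, the assumed bound by the count in
          {1..n} takes over.\<close>
        define s where "s = sqrt ((1 + \<epsilon>) * \<mu> / c0)"
        have s0: "s \<ge> 0" using \<mu>pos c0 eps by (simp add: s_def)
        define M where "M = min n (nat \<lceil>s\<rceil> + 6 * l)"
        have enough: "(1 + \<epsilon>) * \<mu> \<le> edge_count {1..M}"
        proof (cases "M = n")
          case True
          then show ?thesis using \<mu>N1 count[of "{1..n}"] by simp
        next
          case False
          then have M: "M \<ge> 6 * l" "s \<le> M" "M \<le> n" by (auto simp: M_def min_def split: if_splits) linarith
          have "s\<^sup>2 \<le> (real M)\<^sup>2" using M s0 by (intro power_mono) auto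
          moreover have "s\<^sup>2 = (1 + \<epsilon>) * \<mu> / c0" using \<mu>pos c0 eps by (simp add: s_def)
          ultimately have "(1 + \<epsilon>) * \<mu> \<le> c0 * (real M)\<^sup>2" using c0 by (simp add: field_simps)
          also have "\<dots> \<le> card (l_sums l {1..M})" using card_l_sums_ge[OF l M(1)] by (simp add: c0_def)
          also have "\<dots> = edge_count {1..M}" using count[of "{1..M}"] M by (simp add: l_sum_count_def)
          finally show ?thesis .
        qed
        have "p ^ card {1..M} \<le> P"
          unfolding P_def by (rule cluster_lower_tail[OF _ enough]) (auto simp: M_def)
        moreover have "exp (- max C1 C2 * \<Phi>) \<le> p ^ M"
        proof -
          \<comment> \<open>Rounding and the summand 6 l cost an additive 1 + 6 l, which (1 +
            \<epsilon>) \<mu> \<ge> 1 allows to be absorbed into a multiple of sqrt \<mu>.\<close>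
          have "1 \<le> sqrt ((1 + \<epsilon>) * \<mu>)" using \<mu>1 by simp
          then have "(1 + 6 * real l) * 1 \<le> (1 + 6 * real l) * sqrt ((1 + \<epsilon>) * \<mu>)" by (intro mult_left_mono) auto
          then have slack: "1 + 6 * real l \<le> (1 + 6 * real l) * sqrt ((1 + \<epsilon>) * \<mu>)" by (simp only: mult_1_right)
          have "real (nat \<lceil>s\<rceil>) \<le> s + 1" using s0 by linarith
          moreover have "M \<le> nat \<lceil>s\<rceil> + 6 * l" by (simp add: M_def)
          ultimately have "M \<le> s + (1 + 6 * real l)" by linarith
          also have "\<dots> \<le> s + (1 + 6 * real l) * sqrt ((1 + \<epsilon>) * \<mu>)" by (rule add_left_mono[OF slack])
          also have "s = sqrt ((1 + \<epsilon>) / c0) * sqrt \<mu>" by (simp add: s_def flip: real_sqrt_mult)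
          also have "sqrt ((1 + \<epsilon>) / c0) * sqrt \<mu> + (1 + 6 * real l) * sqrt ((1 + \<epsilon>) * \<mu>) = C1 * sqrt \<mu>"
            unfolding C1_def real_sqrt_mult by (simp add: distrib_right)
          also have "\<dots> \<le> max C1 C2 * sqrt \<mu>" using \<mu>pos by (intro mult_right_mono) auto
          finally have "M * ln (1 / p) \<le> max C1 C2 * sqrt \<mu> * ln (1 / p)" using t by (intro mult_right_mono) auto
          then have "- max C1 C2 * \<Phi> \<le> M * ln p" using p by (simp add: \<Phi> ln_div)
          then have "exp (- max C1 C2 * \<Phi>) \<le> exp (M * ln p)" by simp
          also have "\<dots> = p ^ M" using p by (simp add: exp_of_nat_mult)
          finally show ?thesis .
        qed
        ultimately show ?thesis unfolding card_atLeastAtMost diff_Suc_1 by linarith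
      qed
    qed
    then show ?thesis
      unfolding Let_def mean prob P_def[symmetric] \<Phi>_def[symmetric] by blast
  qed
  show ?thesis
    by (rule exI[of _ c], rule exI[of _ "max C1 C2"], rule exI[of _ n0], intro conjI allI impI)
      (use c C1 main in auto)
qed

theorem mainTheorem4:
  shows
    "(\<forall>\<epsilon>::real. \<epsilon> > 0 \<longrightarrow>
        (\<exists>(c::real) (C::real) (n0::nat). c > 0 \<and> C > 0 \<and>
          (\<forall>(n::nat) (p::real). n \<ge> n0 \<and> 0 < p \<and> p \<le> 1 \<longrightarrow>
            (let \<mu> = measure_pmf.expectation (binomial_subset n p) schur_count;
                 \<Phi> = min \<mu> (sqrt \<mu> * ln (1 / p));
                 P = measure_pmf.prob (binomial_subset n p) {A. schur_count A \<ge> (1 + \<epsilon>) * \<mu>}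
             in 1 \<le> (1 + \<epsilon>) * \<mu> \<and> (1 + \<epsilon>) * \<mu> \<le> schur_count {1..n} \<longrightarrow>
                exp (- C * \<Phi>) \<le> P \<and> P \<le> exp (- c * \<Phi>)))))
     \<and>
     (\<forall>l::nat. l \<ge> 1 \<longrightarrow>
       (\<forall>\<epsilon>::real. \<epsilon> > 0 \<longrightarrow>
        (\<exists>(c::real) (C::real) (n0::nat). c > 0 \<and> C > 0 \<and>
          (\<forall>(n::nat) (p::real). n \<ge> n0 \<and> 0 < p \<and> p \<le> 1 \<longrightarrow>
            (let \<mu> = measure_pmf.expectation (binomial_subset n p) (l_sum_count l);
                 \<Phi> = min \<mu> (sqrt \<mu> * ln (1 / p));
                 P = measure_pmf.prob (binomial_subset n p) {A. l_sum_count l A \<ge> (1 + \<epsilon>) * \<mu>}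
             in 1 \<le> (1 + \<epsilon>) * \<mu> \<and> (1 + \<epsilon>) * \<mu> \<le> l_sum_count l {1..n} \<longrightarrow>
                exp (- C * \<Phi>) \<le> P \<and> P \<le> exp (- c * \<Phi>))))))"
proof -
  have schur: "schur_count = l_sum_count 1"
    by (simp add: fun_eq_iff schur_count_def l_sum_count_def schur_triples_eq_l_sums)
  show ?thesis
    unfolding schur by (intro conjI allI impI; rule l_sum_tail_bounds; simp)
qed

end
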